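(* Let $\mathbb{K}$ be a field of characteristic $\neq 2$, let $V$ be a $3$-dimensional vector space over $\mathbb{K}$, and let $\omega$ be a nonzero skew-symmetric bilinear form on $V$. Let $\mathcal{A}_3(\mathbb{K})$ be the variety of all $\omega$-Lie algebras on $V$. Then $\mathcal{A}_3(\mathbb{K})$ is a $6$-dimensional irreducible affine variety, and the corresponding vanishing ideal is a complete intersection.
   Context: An $\omega$-Lie algebra over $\mathbb{K}$ is a triple $(L,[-,-],\omega)$ where $L$ is a finite-dimensional vector space over $\mathbb{K}$, $[-,-]$ is a skew-symmetric bilinear product on $L$, and $\omega:L\times L\to\mathbb{K}$ is a bilinear form such that $[[x,y],z]+[[y,z],x]+[[z,x],y]=\omega(x,y)z+\omega(y,z)x+\omega(z,x)y$ for all $x,y,z\in L$. Fix a basis $\{x,y,z\}$ of $V$. A skew-symmetric bracket on $V$ is determined by the nine scalars $a_i,b_i,c_i\in\mathbb{K}$ ($i=1,2,3$) with $[x,y]=a_1x+a_2y+a_3z$, $[x,z]=b_1x+b_2y+b_3z$, $[y,z]=c_1x+c_2y+c_3z$. The set $\mathcal{A}_3(\mathbb{K})$ of all skew-symmetric brackets on $V$ for which $(V,[-,-],\omega)$ is an $\omega$-Lie algebra is thereby viewed as an affine variety in $\mathbb{K}^9$. Its vanishing ideal is the ideal of all polynomials in $R=\mathbb{K}[x_i,y_i,z_i\mid i=1,2,3]$ (where $x_i,y_i,z_i$ are the coordinate functions dual to $a_i,b_i,c_i$) that vanish on $\mathcal{A}_3(\mathbb{K})$. An ideal is a complete intersection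 if it is generated by a regular sequence in $R$.
   Formalization: Irreducibility and dimension 6 of the set of K-points are claimed only for infinite K (for finite K it is a finite set with more than one point); for every K, finite ones included, all claims are also proved for the points over the algebraic closure. *)

theory Defs
  imports
    "HOL-Analysis.Cartesian_Space"
    "HOL-Library.Poly_Mapping"
    "HOL-Library.Extended_Nat"
    "HOL-Algebra.Algebraic_Closure_Type"
begin

definition bilinear_map ::
  "('k::field \<Rightarrow> 'v::ab_group_add \<Rightarrow> 'v) \<Rightarrow> ('k \<Rightarrow> 'w::ab_group_add \<Rightarrow> 'w) \<Rightarrow> ('v \<Rightarrow> 'v \<Rightarrow> 'w) \<Rightarrow> bool"
  where "bilinear_map s t f \<longleftrightarrow>
    (\<forall>u. Vector_Spaces.linear s t (\<lambda>v. f u v)) \<and> (\<forall>v. Vector_Spaces.linear s t (\<lambda>u. f u v))"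

definition skew_symmetric :: "('v \<Rightarrow> 'v \<Rightarrow> 'w::ab_group_add) \<Rightarrow> bool"
  where "skew_symmetric f \<longleftrightarrow> (\<forall>u v. f u v = - f v u)"

definition omega_lie_algebra ::
  "('k::field \<Rightarrow> 'v::ab_group_add \<Rightarrow> 'v) \<Rightarrow> ('v \<Rightarrow> 'v \<Rightarrow> 'v) \<Rightarrow> ('v \<Rightarrow> 'v \<Rightarrow> 'k) \<Rightarrow> bool"
  where "omega_lie_algebra sc br \<omega> \<longleftrightarrow>
    (\<exists>B. finite_dimensional_vector_space sc B) \<and>
    bilinear_map sc sc br \<and> skew_symmetric br \<and>
    bilinear_map sc (*) \<omega> \<and>
    (\<forall>x y z. br (br x y) z + br (br y z) x + br (br z x) y
           = sc (\<omega> x y) z + sc (\<omega> y z) x + sc (\<omega> z x) y)"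

text \<open>
  A point \<open>p\<close> of the affine space \<open>K\<^sup>9\<close> lists the structure constants in the order
  \<open>a\<^sub>1, a\<^sub>2, a\<^sub>3, b\<^sub>1, b\<^sub>2, b\<^sub>3, c\<^sub>1, c\<^sub>2, c\<^sub>3\<close>.
  (In the index type \<open>9\<close> the numeral 9 denotes the same element as 0, so the nine indices
  below are exactly the elements of the type.)
\<close>

definition structure_constants ::
  "('k::field \<Rightarrow> 'v::ab_group_add \<Rightarrow> 'v) \<Rightarrow> 'v \<Rightarrow> 'v \<Rightarrow> 'v \<Rightarrow> ('v \<Rightarrow> 'v \<Rightarrow> 'v) \<Rightarrow> 'k ^ 9 \<Rightarrow> bool"
  where "structure_constants sc x y z br p \<longleftrightarrow>
    br x y = sc (p $ 1) x + sc (p $ 2) y + sc (p $ 3) z \<and>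
    br x z = sc (p $ 4) x + sc (p $ 5) y + sc (p $ 6) z \<and>
    br y z = sc (p $ 7) x + sc (p $ 8) y + sc (p $ 9) z"

definition omega_lie_variety ::
  "('k::field \<Rightarrow> 'v::ab_group_add \<Rightarrow> 'v) \<Rightarrow> 'v \<Rightarrow> 'v \<Rightarrow> 'v \<Rightarrow> ('v \<Rightarrow> 'v \<Rightarrow> 'k) \<Rightarrow> ('k ^ 9) set"
  where "omega_lie_variety sc x y z \<omega> =
    {p. \<exists>br. omega_lie_algebra sc br \<omega> \<and> structure_constants sc x y z br p}"

text \<open>
  Extension of scalars to the algebraic closure \<open>F\<close> of \<open>K\<close> (over a finite
  field the set of rational points is finite and does not determine the variety): the basis \<open>x, y, z\<close> identifies the
  extended space with \<open>F\<^sup>3\<close>, and \<open>\<omega>\<close> becomes the form on \<open>F\<^sup>3\<close> with the same Gram matrix.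
\<close>

definition geometric_form ::
  "'v::zero \<Rightarrow> 'v \<Rightarrow> 'v \<Rightarrow> ('v \<Rightarrow> 'v \<Rightarrow> 'k::field) \<Rightarrow>
     'k alg_closure ^ 3 \<Rightarrow> 'k alg_closure ^ 3 \<Rightarrow> 'k alg_closure"
  where "geometric_form x y z \<omega> u v =
    (let e = (vector [x, y, z] :: 'v ^ 3)
     in \<Sum>i\<in>UNIV. \<Sum>j\<in>UNIV. u $ i * v $ j * to_ac (\<omega> (e $ i) (e $ j)))"

definition geometric_omega_lie_variety ::
  "'v::zero \<Rightarrow> 'v \<Rightarrow> 'v \<Rightarrow> ('v \<Rightarrow> 'v \<Rightarrow> 'k::field) \<Rightarrow> ('k alg_closure ^ 9) set"
  where "geometric_omega_lie_variety x y z \<omega> =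
    omega_lie_variety (*s) (axis 1 1) (axis 2 1) (axis 3 1) (geometric_form x y z \<omega>)"

text \<open>
  Polynomials in finitely many variables indexed by \<open>'n\<close>: finitely supported families of
  coefficients, indexed by exponent vectors. Multiplication is the convolution product.
\<close>

type_synonym ('n, 'k) mpoly = "('n \<Rightarrow>\<^sub>0 nat) \<Rightarrow>\<^sub>0 'k"

text \<open>Evaluation at a point with coordinates in an extension, along \<open>h\<close> on the coefficients.\<close>

definition eval_mpoly_over ::
  "('k::comm_ring_1 \<Rightarrow> 'f::comm_ring_1) \<Rightarrow> 'f ^ 'n \<Rightarrow> ('n::finite, 'k) mpoly \<Rightarrow> 'f"
  where "eval_mpoly_over h a f =
    (\<Sum>m\<in>Poly_Mapping.keys f. h (Poly_Mapping.lookup f m) * (\<Prod>i\<in>UNIV. (a $ i) ^ Poly_Mapping.lookup m i))"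

abbreviation eval_mpoly :: "'k::comm_ring_1 ^ 'n \<Rightarrow> ('n::finite, 'k) mpoly \<Rightarrow> 'k"
  where "eval_mpoly \<equiv> eval_mpoly_over (\<lambda>c. c)"

definition vanishing_ideal_over ::
  "('k::comm_ring_1 \<Rightarrow> 'f::comm_ring_1) \<Rightarrow> ('f ^ 'n) set \<Rightarrow> ('n::finite, 'k) mpoly set"
  where "vanishing_ideal_over h S = {f. \<forall>a\<in>S. eval_mpoly_over h a f = 0}"

abbreviation vanishing_ideal :: "('k::comm_ring_1 ^ 'n) set \<Rightarrow> ('n::finite, 'k) mpoly set"
  where "vanishing_ideal \<equiv> vanishing_ideal_over (\<lambda>c. c)"

definition zariski_closed :: "('k::field ^ 'n::finite) set \<Rightarrow> bool"
  where "zariski_closed S \<longleftrightarrow> (\<exists>P. S = {a. \<forall>f\<in>P. eval_mpoly a f = 0})"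

definition irreducible_variety :: "('k::field ^ 'n::finite) set \<Rightarrow> bool"
  where "irreducible_variety S \<longleftrightarrow> zariski_closed S \<and> S \<noteq> {} \<and>
    (\<forall>Y Z. zariski_closed Y \<and> zariski_closed Z \<and> S = Y \<union> Z \<longrightarrow> S = Y \<or> S = Z)"

text \<open>
  Krull dimension of a Zariski closed set: the supremum of the lengths \<open>n\<close> of chains
  \<open>Z\<^sub>0 \<subset> \<dots> \<subset> Z\<^sub>n\<close> of irreducible closed subsets. (The empty set gets 0.)
\<close>

definition variety_dim :: "('k::field ^ 'n::finite) set \<Rightarrow> enat"
  where "variety_dim S = (SUP n \<in> {n. \<exists>Z :: nat \<Rightarrow> ('k ^ 'n) set.
    (\<forall>i\<le>n. irreducible_variety (Z i) \<and> Z i \<subseteq> S) \<and> (\<forall>i<n. Z i \<subset> Z (Suc i))}. enat n)"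

text \<open>A commutative ring is a module over itself, and the span of a set is the ideal it generates.\<close>

abbreviation ideal_gen :: "'r::comm_ring_1 set \<Rightarrow> 'r set"
  where "ideal_gen \<equiv> module.span (*)"

definition regular_sequence :: "'r::comm_ring_1 list \<Rightarrow> bool"
  where "regular_sequence fs \<longleftrightarrow> ideal_gen (set fs) \<noteq> UNIV \<and>
    (\<forall>i<length fs. \<forall>g. fs ! i * g \<in> ideal_gen (set (take i fs)) \<longrightarrow> g \<in> ideal_gen (set (take i fs)))"

definition complete_intersection :: "'r::comm_ring_1 set \<Rightarrow> bool"
  where "complete_intersection I \<longleftrightarrow> (\<exists>fs. regular_sequence fs \<and> I = ideal_gen (set fs))"

end

theory Submission
  imports Defs
begin

text \<open>
  Let \<open>M\<close> be the matrix with columns \<open>[y,z]\<close>, \<open>[z,x]\<close>, \<open>[x,y]\<close>, let \<open>S\<close> be its symmetric part and let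
  \<open>t = (M\<^sub>2\<^sub>3 - M\<^sub>3\<^sub>2, M\<^sub>3\<^sub>1 - M\<^sub>1\<^sub>3, M\<^sub>1\<^sub>2 - M\<^sub>2\<^sub>1)\<close> encode its skew part. Both sides of the defining identity are
  alternating and trilinear, so the identity needs to be checked at \<open>x, y, z\<close> only. There it reads
  \<open>M t = w\<close> with \<open>w = (\<omega>(y,z), \<omega>(z,x), \<omega>(x,y)) \<noteq> 0\<close>. The skew part of \<open>M\<close> annihilates \<open>t\<close>, so the
  equation is \<open>S t = w\<close>: three equations for a symmetric matrix \<open>S\<close> and a vector \<open>t\<close>, which
  is automatically nonzero. For fixed \<open>t \<noteq> 0\<close> the map \<open>S \<mapsto> S t\<close> is onto, and an explicit symmetric
  matrix \<open>E\<close> with \<open>E t = r\<close>, rational in \<open>t\<close> and linear in \<open>r\<close>, is all the geometry that the proof uses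
  (\<open>jac_add_correction\<close>).

  \<^item> \<^emph>\<open>Irreducibility.\<close> Interpolate linearly between two points and remove the error in \<open>S t\<close> by \<open>E\<close>: this
    gives a rational curve in the variety through both points (\<open>curve_exists\<close>). If a product \<open>f g\<close> vanishes
    on the variety, restricting to such a curve leaves a statement about polynomials in one
    variable (\<open>vanishing_ideal_prime\<close>). The same holds if only some of the three equations are imposed,
    as long as they force \<open>t \<noteq> 0\<close>.

  \<^item> \<^emph>\<open>The ideal.\<close> Let \<open>J\<close> be the ideal of the three equations. Adding \<open>E\<close> retracts the open set
    \<open>t\<^sub>i \<noteq> 0\<close> onto the variety and moves each coordinate by an element of \<open>J\<close> divided by \<open>t\<^sub>i\<^sup>2\<close>. So a
    polynomial \<open>g\<close> that vanishes on the variety lies in \<open>J\<close> after multiplication by a power of each \<open>t\<^sub>i\<close>. Modulo \<open>J\<close> the nonzero constants among the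
    \<open>w\<^sub>i\<close> are combinations of the \<open>t\<^sub>i\<close>, so \<open>g \<in> J\<close> (\<open>vanishing_ideal_jac_locus\<close>). If an equation with
    \<open>w\<^sub>i \<noteq> 0\<close> comes first, primality of the ideals of one and of two equations makes the three
    equations a regular sequence.

  \<^item> \<^emph>\<open>Finite fields.\<close> Over a finite field the rational points are a finite set, whose vanishing ideal is
    larger than \<open>J\<close>. The vanishing ideal of every finite nonempty set of points in \<open>n\<close>-space is generated by a
    regular sequence of length \<open>n\<close>, with one element for each variable (\<open>complete_intersection_finite\<close>).

  \<^item> \<^emph>\<open>Dimension.\<close> A chain of \<open>n + 1\<close> irreducible closed sets provides \<open>n\<close> algebraically independent functions
    on the largest one. On the variety, after multiplication by powers of \<open>t\<^sub>1\<close>, all functions are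
    polynomials in six coordinates, and counting monomials excludes seven independent ones. A chain of
    length six comes from the slice \<open>t\<^sub>1 = 1\<close>, which is the graph of a polynomial map on affine 5-space.

  Primality and the computation of the ideals are carried out for polynomials over \<open>K\<close> evaluated at points
  over an infinite extension field \<open>F\<close>; taking \<open>F = K\<close> or the algebraic closure of \<open>K\<close> covers the
  rational and the geometric variety.
\<close>

(* vector components and coefficients of formal power series share the infix dollar sign *)
no_notation fps_nth (infixl \<open>$\<close> 75)

section \<open>Polynomial functions\<close>

definition mconst :: "'k::comm_ring_1 \<Rightarrow> ('n, 'k) mpoly"
  where "mconst c = Poly_Mapping.single 0 c"

definition mvar :: "'n \<Rightarrow> ('n, 'k::comm_ring_1) mpoly"
  where "mvar i = Poly_Mapping.single (Poly_Mapping.single i 1) 1"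

lemma single_power_one:
  "Poly_Mapping.single (Poly_Mapping.single i 1) (1::'k::comm_ring_1) ^ k
    = Poly_Mapping.single (Poly_Mapping.single i k) 1"
  by (induction k) (auto simp: mult_single single_add[symmetric])

lemma single_eq_prod_mvar:
  fixes c :: "'k::comm_ring_1" and m :: "'n::finite \<Rightarrow>\<^sub>0 nat"
  shows "Poly_Mapping.single m c = mconst c * (\<Prod>i\<in>UNIV. mvar i ^ Poly_Mapping.lookup m i)"
proof -
  have prod: "(\<Prod>i\<in>A. mvar i ^ Poly_Mapping.lookup m i)
      = Poly_Mapping.single (\<Sum>i\<in>A. Poly_Mapping.single i (Poly_Mapping.lookup m i)) (1::'k)"
    if "finite A" for A
    using that
    by (induction A rule: finite_induct)
       (auto simp: mvar_def single_power_one mult_single simp del: One_nat_def)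
  have "(\<Sum>i\<in>UNIV. Poly_Mapping.single i (Poly_Mapping.lookup m i)) = m"
    by (intro poly_mapping_eqI) (simp add: lookup_sum lookup_single when_def)
  then show ?thesis
    by (simp add: prod mconst_def mult_single)
qed

lemma mpoly_sum_singles:
  "f = (\<Sum>m\<in>Poly_Mapping.keys f. Poly_Mapping.single m (Poly_Mapping.lookup f m))"
  by (intro poly_mapping_eqI)
     (auto simp: lookup_sum lookup_single when_def in_keys_iff sum.delta' not_in_keys_iff_lookup_eq_zero)

text \<open>
  Constants and variables generate the polynomial ring. Statements about all polynomials, such as
  clearing denominators along a curve, are closed under sums and products and follow from this rule.
\<close>

lemma mpoly_induct [case_names const var add mult]:
  fixes P :: "('n::finite, 'k::comm_ring_1) mpoly \<Rightarrow> bool"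
  assumes c: "\<And>c. P (mconst c)" and v: "\<And>i. P (mvar i)"
    and a: "\<And>f g. P f \<Longrightarrow> P g \<Longrightarrow> P (f + g)" and m: "\<And>f g. P f \<Longrightarrow> P g \<Longrightarrow> P (f * g)"
  shows "P f"
proof -
  have zero: "P 0" and one: "P 1"
    using c[of 0] c[of 1] by (simp_all add: mconst_def)
  have pow: "P (g ^ k)" if "P g" for g k
    using that by (induction k) (auto intro: one m)
  have prod: "P (\<Prod>i\<in>A. g i)" if "\<And>i. P (g i)" for A :: "'n set" and g
    using finite[of A] by (induction A rule: finite_induct) (auto intro: one m that)
  have sing: "P (Poly_Mapping.single m c)" for m c
    unfolding single_eq_prod_mvar by (intro m c prod pow v)
  have sum: "P (\<Sum>m\<in>A. Poly_Mapping.single m (Poly_Mapping.lookup f m))" if "finite A" for A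
    using that by (induction A rule: finite_induct) (auto intro: zero a sing)
  show ?thesis
    by (subst mpoly_sum_singles) (rule sum, simp)
qed

text \<open>
  Besides field embeddings, evaluation at a point is a map of this kind, for polynomials in one or in
  several variables. This transports formulas for brackets from polynomial rings to points.
\<close>

locale coefficient_map =
  fixes h :: "'k::comm_ring_1 \<Rightarrow> 'f::comm_ring_1"
  assumes h_0 [simp]: "h 0 = 0" and h_1 [simp]: "h 1 = 1"
    and h_add [simp]: "h (c + d) = h c + h d" and h_mult [simp]: "h (c * d) = h c * h d"
begin

lemma h_minus [simp]: "h (- c) = - h c"
  using h_add[of c "- c"] by (simp add: add_eq_0_iff2)

lemma h_diff [simp]: "h (c - d) = h c - h d"
  using h_add[of c "- d"] by simp

lemma h_prod: "h (\<Prod>i\<in>S. f i) = (\<Prod>i\<in>S. h (f i))"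
  by (induction S rule: infinite_finite_induct) auto

lemma h_sum: "h (\<Sum>i\<in>S. f i) = (\<Sum>i\<in>S. h (f i))"
  by (induction S rule: infinite_finite_induct) auto

lemma eval_superset:
  assumes "finite S" "Poly_Mapping.keys f \<subseteq> S"
  shows "eval_mpoly_over h a f
    = (\<Sum>m\<in>S. h (Poly_Mapping.lookup f m) * (\<Prod>i\<in>UNIV. (a $ i) ^ Poly_Mapping.lookup m i))"
  unfolding eval_mpoly_over_def
  by (rule sum.mono_neutral_left) (use assms in \<open>auto simp: in_keys_iff\<close>)

lemma eval_add [simp]: "eval_mpoly_over h a (f + g) = eval_mpoly_over h a f + eval_mpoly_over h a g"
proof -
  let ?S = "Poly_Mapping.keys f \<union> Poly_Mapping.keys g"
  have "Poly_Mapping.keys (f + g) \<subseteq> ?S" by (rule keys_add)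
  then show ?thesis
    by (subst (1 2 3) eval_superset[of ?S])
       (auto simp: lookup_add distrib_right sum.distrib)
qed

lemma eval_0 [simp]: "eval_mpoly_over h a 0 = 0"
  by (simp add: eval_mpoly_over_def)

lemma eval_sum: "eval_mpoly_over h a (\<Sum>i\<in>S. f i) = (\<Sum>i\<in>S. eval_mpoly_over h a (f i))"
  by (induction S rule: infinite_finite_induct) auto

lemma eval_single:
  "eval_mpoly_over h a (Poly_Mapping.single m c)
    = h c * (\<Prod>i\<in>UNIV. (a $ i) ^ Poly_Mapping.lookup m i)"
  by (cases "c = 0") (auto simp: eval_mpoly_over_def)

lemma eval_const [simp]: "eval_mpoly_over h a (mconst c) = h c"
  by (simp add: mconst_def eval_single)

lemma eval_1 [simp]: "eval_mpoly_over h a 1 = 1"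
  using eval_const[of a 1] by (simp add: mconst_def)

lemma eval_var [simp]: "eval_mpoly_over h a (mvar i) = a $ i"
proof -
  have "(\<Prod>j\<in>UNIV. (a $ j) ^ Poly_Mapping.lookup (Poly_Mapping.single i 1) j)
      = (\<Prod>j\<in>UNIV. if j = i then a $ i else 1)"
    by (intro prod.cong) (auto simp: lookup_single when_def)
  then show ?thesis
    by (simp add: mvar_def eval_single)
qed

lemma eval_mult [simp]: "eval_mpoly_over h a (f * g) = eval_mpoly_over h a f * eval_mpoly_over h a g"
proof -
  let ?s = "Poly_Mapping.single" and ?l = "Poly_Mapping.lookup" and ?e = "eval_mpoly_over h a"
  have sing: "?e (?s m c * ?s n d) = ?e (?s m c) * ?e (?s n d)" for m n c d
    by (simp add: mult_single eval_single lookup_add power_add prod.distrib algebra_simps)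
  have "?e (f * g) = ?e ((\<Sum>m\<in>Poly_Mapping.keys f. ?s m (?l f m)) * (\<Sum>n\<in>Poly_Mapping.keys g. ?s n (?l g n)))"
    by (simp flip: mpoly_sum_singles)
  also have "\<dots> = (\<Sum>m\<in>Poly_Mapping.keys f. ?e (?s m (?l f m))) * (\<Sum>n\<in>Poly_Mapping.keys g. ?e (?s n (?l g n)))"
    by (simp add: sum_product eval_sum sing)
  also have "\<dots> = ?e f * ?e g"
    by (simp flip: eval_sum mpoly_sum_singles)
  finally show ?thesis .
qed

lemma eval_minus [simp]: "eval_mpoly_over h a (- f) = - eval_mpoly_over h a f"
  using eval_add[of a f "- f"] by (simp add: add_eq_0_iff2)

lemma eval_diff [simp]: "eval_mpoly_over h a (f - g) = eval_mpoly_over h a f - eval_mpoly_over h a g"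
  using eval_add[of a f "- g"] by simp

lemma eval_power [simp]: "eval_mpoly_over h a (f ^ k) = eval_mpoly_over h a f ^ k"
  by (induction k) auto

lemma eval_prod: "eval_mpoly_over h a (\<Prod>i\<in>S. f i) = (\<Prod>i\<in>S. eval_mpoly_over h a (f i))"
  by (induction S rule: infinite_finite_induct) auto

end

text \<open>
  Induction on the set of variables: with the other variables fixed, a polynomial in one variable with
  infinitely many zeros is zero. So the coefficient of each of its powers, a polynomial in fewer
  variables, vanishes everywhere.
\<close>

lemma sum_monomials_eq_0D:
  fixes c :: "('n::finite \<Rightarrow>\<^sub>0 nat) \<Rightarrow> 'f::field"
  assumes inf: "infinite (UNIV :: 'f set)" and "finite V"
    and "finite S" "\<And>m n. m \<in> S \<Longrightarrow> n \<in> S \<Longrightarrow>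
      (\<And>i. i \<in> V \<Longrightarrow> Poly_Mapping.lookup m i = Poly_Mapping.lookup n i) \<Longrightarrow> m = n"
    and "\<And>a :: 'f ^ 'n. (\<Sum>m\<in>S. c m * (\<Prod>i\<in>V. (a $ i) ^ Poly_Mapping.lookup m i)) = 0"
    and "m \<in> S"
  shows "c m = 0"
  using assms(2-6)
proof (induction V arbitrary: S m rule: finite_induct)
  case empty
  then have "S = {m}" by blast
  with empty show ?case by simp
next
  case (insert v V)
  let ?l = "Poly_Mapping.lookup"
  define T where "T e = {m \<in> S. ?l m v = e}" for e
  let ?q = "\<lambda>a e. \<Sum>m\<in>T e. c m * (\<Prod>i\<in>V. (a $ i) ^ ?l m i)"
  have q0: "?q a e = 0" for a :: "'f ^ 'n" and e
  proof -
    define p where "p = (\<Sum>m\<in>S. Polynomial.monom (c m * (\<Prod>i\<in>V. (a $ i) ^ ?l m i)) (?l m v))"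
    have "poly p x = 0" for x
    proof -
      define b :: "'f ^ 'n" where "b = (\<chi> i. if i = v then x else a $ i)"
      have "(\<Prod>i\<in>V. (b $ i) ^ ?l m i) = (\<Prod>i\<in>V. (a $ i) ^ ?l m i)" for m
        using insert.hyps by (intro prod.cong) (auto simp: b_def)
      then have "poly p x = (\<Sum>m\<in>S. c m * (\<Prod>i\<in>insert v V. (b $ i) ^ ?l m i))"
        using insert.hyps by (simp add: p_def poly_sum poly_monom b_def algebra_simps)
      then show ?thesis using insert.prems(3) by simp
    qed
    then have "p = 0"
      using poly_roots_finite[of p] inf by auto
    then have "0 = Polynomial.coeff p e" by simp
    also have "\<dots> = ?q a e"
      unfolding p_def T_def coeff_sum
      by (subst sum.inter_filter[OF insert.prems(1)]) (auto intro!: sum.cong)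
    finally show ?thesis by simp
  qed
  have "x = y" if "x \<in> T (?l m v)" "y \<in> T (?l m v)" "\<And>i. i \<in> V \<Longrightarrow> ?l x i = ?l y i" for x y
  proof (rule insert.prems(2))
    show "?l x i = ?l y i" if "i \<in> insert v V" for i
      using that \<open>x \<in> T _\<close> \<open>y \<in> T _\<close> \<open>\<And>i. i \<in> V \<Longrightarrow> ?l x i = ?l y i\<close>
      by (auto simp: T_def)
  qed (use that in \<open>auto simp: T_def\<close>)
  then show ?case
    using insert.IH[of "T (?l m v)" m] q0 insert.prems by (auto simp: T_def)
qed

text \<open>
  Polynomials over \<open>k\<close> are tested at points over \<open>f\<close>, which must be infinite for polynomials to be
  determined by their values; \<open>k\<close> may be finite.
\<close>

locale infinite_extension = coefficient_map h
  for h :: "'k::field \<Rightarrow> 'f::field" +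
  assumes infinite_field: "infinite (UNIV :: 'f set)"
begin

lemma h_eq_0_iff [simp]: "h c = 0 \<longleftrightarrow> c = 0"
proof
  assume "h c = 0"
  then show "c = 0"
    using h_mult[of c "inverse c"] by (cases "c = 0") auto
qed simp

lemma h_eq_iff [simp]: "h c = h d \<longleftrightarrow> c = d"
  using h_eq_0_iff[of "c - d"] by (simp del: h_eq_0_iff)

lemma mpoly_eq_0I:
  fixes f :: "('n::finite, 'k) mpoly"
  assumes "\<And>a. eval_mpoly_over h a f = 0"
  shows "f = 0"
proof (rule poly_mapping_eqI)
  fix m
  have "h (Poly_Mapping.lookup f m) = 0" if "m \<in> Poly_Mapping.keys f"
    using infinite_field finite[of UNIV] finite_keys _ _ that
  proof (rule sum_monomials_eq_0D)
  qed (use assms in \<open>auto simp: eval_mpoly_over_def intro: poly_mapping_eqI\<close>)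
  then show "Poly_Mapping.lookup f m = Poly_Mapping.lookup 0 m"
    by (cases "m \<in> Poly_Mapping.keys f") (auto simp: in_keys_iff)
qed

end

section \<open>Rational curves\<close>

definition curve_point :: "'f::field poly ^ 'n \<Rightarrow> 'f poly \<Rightarrow> 'f \<Rightarrow> 'f ^ 'n"
  where "curve_point num den s = (\<chi> i. poly (num $ i) s / poly den s)"

text \<open>
  The curve may have poles, and it has to stay in the set only where it is defined.
\<close>

definition rationally_connected :: "('f::field ^ 'n) set \<Rightarrow> bool"
  where "rationally_connected S \<longleftrightarrow> (\<forall>p\<in>S. \<forall>q\<in>S. \<exists>num den.
    poly den 0 \<noteq> 0 \<and> poly den 1 \<noteq> 0 \<and> curve_point num den 0 = p \<and> curve_point num den 1 = q \<and>
    (\<forall>s. poly den s \<noteq> 0 \<longrightarrow> curve_point num den s \<in> S))"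

context infinite_extension
begin

lemma eval_on_curve:
  fixes f :: "('n::finite, 'k) mpoly"
  shows "\<exists>N P. \<forall>s. poly den s \<noteq> 0 \<longrightarrow>
    eval_mpoly_over h (curve_point num den s) f * poly den s ^ N = poly P s"
proof -
  have sum_rule: "(x + y) * d ^ (N + M) = (x * d ^ N) * d ^ M + (y * d ^ M) * d ^ N"
    and prod_rule: "(x * y) * d ^ (N + M) = (x * d ^ N) * (y * d ^ M)" for x y d :: 'f and N M
    by (simp_all add: power_add algebra_simps)
  show ?thesis
  proof (induction f rule: mpoly_induct)
    case (const c)
    show ?case by (rule exI[of _ 0], rule exI[of _ "[:h c:]"]) simp
  next
    case (var i)
    show ?case by (rule exI[of _ 1], rule exI[of _ "num $ i"]) (simp add: curve_point_def)
  next
    case (add f g)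
    then obtain N M P Q where
      "\<And>s. poly den s \<noteq> 0 \<Longrightarrow> eval_mpoly_over h (curve_point num den s) f * poly den s ^ N = poly P s"
      "\<And>s. poly den s \<noteq> 0 \<Longrightarrow> eval_mpoly_over h (curve_point num den s) g * poly den s ^ M = poly Q s"
      by blast
    then show ?case
      by (intro exI[of _ "N + M"] exI[of _ "P * den ^ M + Q * den ^ N"])
         (auto simp: sum_rule)
  next
    case (mult f g)
    then obtain N M P Q where
      "\<And>s. poly den s \<noteq> 0 \<Longrightarrow> eval_mpoly_over h (curve_point num den s) f * poly den s ^ N = poly P s"
      "\<And>s. poly den s \<noteq> 0 \<Longrightarrow> eval_mpoly_over h (curve_point num den s) g * poly den s ^ M = poly Q s"
      by blast
    then show ?case
      by (intro exI[of _ "N + M"] exI[of _ "P * Q"])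
         (auto simp: prod_rule)
  qed
qed

text \<open>
  Take a rational curve from a point where \<open>f\<close> does not vanish to a point where \<open>g\<close> does not vanish. Along
  it, \<open>f\<close> and \<open>g\<close> become nonzero polynomials in one variable after denominators are cleared, so their
  product cannot vanish at all but finitely many parameters.
\<close>

lemma vanishing_ideal_prime:
  fixes f g :: "('n::finite, 'k) mpoly" and S :: "('f ^ 'n) set"
  assumes S: "rationally_connected S" and fg: "f * g \<in> vanishing_ideal_over h S"
  shows "f \<in> vanishing_ideal_over h S \<or> g \<in> vanishing_ideal_over h S"
proof (rule ccontr)
  assume "\<not> ?thesis"
  then obtain p q where "p \<in> S" "q \<in> S"
    and p: "eval_mpoly_over h p f \<noteq> 0" and q: "eval_mpoly_over h q g \<noteq> 0"
    by (auto simp: vanishing_ideal_over_def)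
  then obtain num den where den: "poly den 0 \<noteq> 0" "poly den 1 \<noteq> 0"
    and ends: "curve_point num den 0 = p" "curve_point num den 1 = q"
    and inS: "\<And>s. poly den s \<noteq> 0 \<Longrightarrow> curve_point num den s \<in> S"
    using S unfolding rationally_connected_def by meson
  obtain N P where P:
    "\<And>s. poly den s \<noteq> 0 \<Longrightarrow> eval_mpoly_over h (curve_point num den s) f * poly den s ^ N = poly P s"
    using eval_on_curve[of den num f] by blast
  obtain M Q where Q:
    "\<And>s. poly den s \<noteq> 0 \<Longrightarrow> eval_mpoly_over h (curve_point num den s) g * poly den s ^ M = poly Q s"
    using eval_on_curve[of den num g] by blast
  have "poly (P * Q * den) s = 0" for s
  proof (cases "poly den s = 0")
    case False
    then have "eval_mpoly_over h (curve_point num den s) (f * g) = 0"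
      using fg inS by (auto simp: vanishing_ideal_over_def)
    then show ?thesis
      using P[OF False] Q[OF False] by (auto simp flip: P Q)
  qed simp
  then have "P * Q * den = 0"
    using poly_roots_finite[of "P * Q * den"] infinite_field by auto
  moreover have "P \<noteq> 0"
    using P[OF den(1)] p ends den by auto
  moreover have "Q \<noteq> 0"
    using Q[OF den(2)] q ends den by auto
  ultimately show False using den by auto
qed

end

section \<open>The Jacobi vector of a bracket\<close>

definition vmap :: "('a \<Rightarrow> 'b) \<Rightarrow> 'a ^ 'n \<Rightarrow> 'b ^ 'n"
  where "vmap \<phi> v = (\<chi> i. \<phi> (v $ i))"

lemma vmap_nth [simp]: "vmap \<phi> v $ i = \<phi> (v $ i)"
  by (simp add: vmap_def)

definition dot :: "'a::comm_ring_1 ^ 3 \<Rightarrow> 'a ^ 3 \<Rightarrow> 'a"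
  where "dot u v = u $ 1 * v $ 1 + u $ 2 * v $ 2 + u $ 3 * v $ 3"

text \<open>
  The structure constants form the matrix \<open>M\<close> with columns \<open>[y,z]\<close>, \<open>[z,x]\<close>, \<open>[x,y]\<close>. This vector is
  \<open>(M\<^sub>2\<^sub>3 - M\<^sub>3\<^sub>2, M\<^sub>3\<^sub>1 - M\<^sub>1\<^sub>3, M\<^sub>1\<^sub>2 - M\<^sub>2\<^sub>1)\<close>, which encodes the skew part of \<open>M\<close>.
\<close>

definition tvec :: "'a::comm_ring_1 ^ 9 \<Rightarrow> 'a ^ 3"
  where "tvec p = vector [p $ 2 + p $ 6, p $ 9 - p $ 1, - p $ 4 - p $ 8]"

text \<open>
  The product \<open>M t\<close>. Its entries are the coefficients at \<open>x, y, z\<close> of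
  \<open>[[x,y],z] + [[y,z],x] + [[z,x],y]\<close>.
\<close>

definition jac :: "'a::comm_ring_1 ^ 9 \<Rightarrow> 'a ^ 3"
  where "jac p = vector
    [tvec p $ 1 * p $ 7 - tvec p $ 2 * p $ 4 + tvec p $ 3 * p $ 1,
     tvec p $ 1 * p $ 8 - tvec p $ 2 * p $ 5 + tvec p $ 3 * p $ 2,
     tvec p $ 1 * p $ 9 - tvec p $ 2 * p $ 6 + tvec p $ 3 * p $ 3]"

text \<open>
  The bracket whose matrix is the symmetric matrix with upper triangle \<open>C\<close>.
\<close>

definition sym_point :: "('n::{one,numeral} \<Rightarrow> 'n \<Rightarrow> 'a::comm_ring_1) \<Rightarrow> 'a ^ 9"
  where "sym_point C = (\<chi> k.
    if k = 1 then C 1 3 else if k = 2 then C 2 3 else if k = 3 then C 3 3 else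
    if k = 4 then - C 1 2 else if k = 5 then - C 2 2 else if k = 6 then - C 2 3 else
    if k = 7 then C 1 1 else if k = 8 then C 1 2 else C 1 3)"

text \<open>
  The symmetric matrix \<open>E = (u r\<^sup>T + r u\<^sup>T) / (u\<cdot>t) - (r\<cdot>t) u u\<^sup>T / (u\<cdot>t)\<^sup>2\<close> satisfies \<open>E t = r\<close>. Its multiple by
  \<open>(u\<cdot>t)\<^sup>2\<close> makes sense over every ring.
\<close>

definition correction :: "'a::comm_ring_1 ^ 3 \<Rightarrow> 'a ^ 3 \<Rightarrow> 'a ^ 3 \<Rightarrow> 'a ^ 9"
  where "correction u r t = sym_point
    (\<lambda>i j. dot u t * (u $ i * r $ j + r $ i * u $ j) - dot r t * (u $ i * u $ j))"

lemma exhaust_9: "k = 1 \<or> k = 2 \<or> k = 3 \<or> k = 4 \<or> k = 5 \<or> k = 6 \<or> k = 7 \<or> k = 8 \<or> k = (9::9)"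
proof (induct k)
  case (of_int z)
  then have "0 \<le> z" and "z < 9" by simp_all
  then have "z = 0 \<or> z = 1 \<or> z = 2 \<or> z = 3 \<or> z = 4 \<or> z = 5 \<or> z = 6 \<or> z = 7 \<or> z = 8" by arith
  then show ?case by auto
qed

lemma forall_9: "(\<forall>k::9. P k) \<longleftrightarrow> P 1 \<and> P 2 \<and> P 3 \<and> P 4 \<and> P 5 \<and> P 6 \<and> P 7 \<and> P 8 \<and> P 9"
  by (metis exhaust_9)

lemma sym_point_nth [simp]:
  "sym_point C $ 1 = C 1 3" "sym_point C $ 2 = C 2 3" "sym_point C $ 3 = C 3 3"
  "sym_point C $ 4 = - C 1 2" "sym_point C $ 5 = - C 2 2" "sym_point C $ 6 = - C 2 3"
  "sym_point C $ 7 = C 1 1" "sym_point C $ 8 = C 1 2" "sym_point C $ 9 = C 1 3"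
  by (simp_all add: sym_point_def)

lemma tvec_add: "tvec (p + q) = tvec p + tvec q"
  by (simp add: tvec_def vec_eq_iff forall_3)

lemma tvec_scale: "tvec (c *s p) = c *s tvec p"
  by (simp add: tvec_def vec_eq_iff forall_3 algebra_simps)

lemma tvec_correction: "tvec (correction u r t) = 0"
  by (simp add: tvec_def correction_def vec_eq_iff forall_3)

text \<open>
  A symmetric summand leaves \<open>t\<close> unchanged, so it changes \<open>M t\<close> by exactly \<open>r\<close>: the Jacobi vector of a bracket
  can be prescribed.
\<close>

lemma jac_add_correction:
  assumes "c * dot u (tvec p) ^ 2 = 1"
  shows "jac (p + c *s correction u r (tvec p)) = jac p + r"
proof -
  let ?q = "p + c *s correction u r (tvec p)"
  have t: "tvec ?q = tvec p"
    by (simp add: tvec_add tvec_scale tvec_correction)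
  have "jac ?q = jac p + (c * dot u (tvec p) ^ 2) *s r"
    unfolding jac_def[of ?q] jac_def[of p] t
    by (simp add: correction_def dot_def vec_eq_iff forall_3 power2_eq_square algebra_simps)
  then show ?thesis by (simp add: assms)
qed

context coefficient_map
begin

lemma vmap_diff: "vmap h (v - w) = vmap h v - vmap h w"
  by (simp add: vec_eq_iff)

lemma h_2 [simp]: "h 2 = 2"
  using h_add[of 1 1] by simp

lemma h_dot: "h (dot u v) = dot (vmap h u) (vmap h v)"
  by (simp add: dot_def)

lemma vmap_tvec: "vmap h (tvec p) = tvec (vmap h p)"
  by (simp add: tvec_def vec_eq_iff forall_3)

lemma vmap_jac: "vmap h (jac p) = jac (vmap h p)"
  by (simp add: jac_def vec_eq_iff forall_3 flip: vmap_tvec)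

lemma vmap_correction: "vmap h (correction u r t) = correction (vmap h u) (vmap h r) (vmap h t)"
  by (simp add: correction_def vec_eq_iff forall_9 h_dot)

end

definition segment :: "'f::comm_ring_1 ^ 'n \<Rightarrow> 'f ^ 'n \<Rightarrow> 'f poly ^ 'n"
  where "segment v w = (\<chi> i. [:v $ i, w $ i - v $ i:])"

lemma segment_at: "vmap (\<lambda>P. poly P s) (segment v w) = (1 - s) *s v + s *s w"
  by (simp add: segment_def vec_eq_iff algebra_simps)

text \<open>
  The correction is applied to the linear interpolation of the two brackets, with \<open>r\<close> the difference between the
  interpolated Jacobi vectors and the Jacobi vector of the interpolation. This \<open>r\<close> vanishes at both ends,
  so the end points are kept. The last conclusion shows that coordinates which the correction fixes are
  interpolated linearly.
\<close>

lemma curve_exists: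
  fixes p q :: "'f::field ^ 9"
  assumes "dot u (tvec p) \<noteq> 0" "dot u (tvec q) \<noteq> 0"
  obtains num den where "poly den 0 \<noteq> 0" "poly den 1 \<noteq> 0"
    "curve_point num den 0 = p" "curve_point num den 1 = q"
    "\<And>s. poly den s \<noteq> 0 \<Longrightarrow> jac (curve_point num den s) = (1 - s) *s jac p + s *s jac q"
    "\<And>s. poly den s \<noteq> 0 \<Longrightarrow> \<exists>c r t. curve_point num den s = (1 - s) *s p + s *s q + c *s correction u r t"
proof -
  interpret at: coefficient_map "\<lambda>P. poly P s" for s :: 'f
    by unfold_locales auto
  define L where "L = segment p q"
  define U :: "'f poly ^ 3" where "U = (\<chi> i. [:u $ i:])"
  define R where "R = segment (jac p) (jac q) - jac L"
  define den where "den = dot U (tvec L) ^ 2"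
  define num where "num = den *s L + correction U R (tvec L)"
  define l where "l s = (1 - s) *s p + s *s q" for s
  define r where "r s = (1 - s) *s jac p + s *s jac q - jac (l s)" for s
  have L: "vmap (\<lambda>P. poly P s) L = l s" for s
    by (simp add: L_def l_def segment_at)
  have U: "vmap (\<lambda>P. poly P s) U = u" for s
    by (simp add: U_def vec_eq_iff)
  have R: "vmap (\<lambda>P. poly P s) R = r s" for s
    using at.vmap_jac[of s L]
    by (simp add: R_def at.vmap_diff segment_at L r_def)
  have den: "poly den s = dot u (tvec (l s)) ^ 2" for s
    using at.h_dot[of U "tvec L" s]
      at.vmap_tvec[of s L]
    by (simp add: den_def U L)
  have pt: "curve_point num den s = l s + inverse (poly den s) *s correction u (r s) (tvec (l s))"
    if "poly den s \<noteq> 0" for s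
  proof -
    have "poly (num $ i) s = poly den s * l s $ i + correction u (r s) (tvec (l s)) $ i" for i
      using at.vmap_correction[of s U R "tvec L"]
        at.vmap_tvec[of s L] L[of s]
      by (simp add: num_def U R vec_eq_iff)
    then show ?thesis
      using that by (simp add: curve_point_def vec_eq_iff field_simps)
  qed
  have l01: "l 0 = p" "l 1 = q" by (simp_all add: l_def)
  have r01: "r 0 = 0" "r 1 = 0" by (simp_all add: r_def l01)
  have correction0: "correction u 0 t = 0" for t
    by (simp add: correction_def vec_eq_iff forall_9 dot_def)
  show ?thesis
  proof (rule that[of den num])
    show d: "poly den 0 \<noteq> 0" "poly den 1 \<noteq> 0" using assms by (simp_all add: den l01)
    show "curve_point num den 0 = p" "curve_point num den 1 = q"
      using d by (simp_all add: pt l01 r01 correction0)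
    show "jac (curve_point num den s) = (1 - s) *s jac p + s *s jac q" if "poly den s \<noteq> 0" for s
      using that unfolding pt[OF that]
      by (subst jac_add_correction) (simp_all add: den r_def)
    show "\<exists>c r t. curve_point num den s = (1 - s) *s p + s *s q + c *s correction u r t"
      if "poly den s \<noteq> 0" for s
      using pt[OF that] unfolding l_def by blast
  qed
qed

lemma dot_axis: "dot (axis i 1) v = v $ i"
  using exhaust_3[of i] by (auto simp: dot_def axis_def)

lemma common_functional:
  fixes t t' :: "'f::field ^ 3"
  assumes "t \<noteq> 0" "t' \<noteq> 0"
  obtains u where "dot u t \<noteq> 0" "dot u t' \<noteq> 0"
proof -
  have dot_add: "dot (u + v) t = dot u t + dot v t" for u v t :: "'f ^ 3"
    by (simp add: dot_def algebra_simps)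
  obtain i j where ij: "t $ i \<noteq> 0" "t' $ j \<noteq> 0"
    using assms by (auto simp: vec_eq_iff)
  consider "t' $ i \<noteq> 0" | "t $ j \<noteq> 0" | "t' $ i = 0" "t $ j = 0" by blast
  then show ?thesis
    by cases (use ij that[of "axis i 1"] that[of "axis j 1"] that[of "axis i 1 + axis j 1"]
      in \<open>auto simp: dot_axis dot_add\<close>)
qed

lemma tvec_nonzero: "jac p \<noteq> 0 \<Longrightarrow> tvec p \<noteq> 0"
  by (auto simp: jac_def vec_eq_iff forall_3)

text \<open>
  Only the equations with index in \<open>I\<close> are imposed: a regular sequence involves the loci of the first equations
  as well.
\<close>

definition jac_locus :: "3 set \<Rightarrow> 'f::field ^ 3 \<Rightarrow> ('f ^ 9) set"
  where "jac_locus I w = {p. \<forall>i\<in>I. jac p $ i = w $ i}"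

lemma rationally_connected_jac_locus:
  assumes "i \<in> I" "w $ i \<noteq> 0"
  shows "rationally_connected (jac_locus I w)"
  unfolding rationally_connected_def
proof (intro ballI)
  fix p q assume p: "p \<in> jac_locus I w" and q: "q \<in> jac_locus I w"
  then have "jac p $ i \<noteq> 0" "jac q $ i \<noteq> 0" using assms by (auto simp: jac_locus_def)
  then have "tvec p \<noteq> 0" "tvec q \<noteq> 0" using tvec_nonzero by force+
  then obtain u where "dot u (tvec p) \<noteq> 0" "dot u (tvec q) \<noteq> 0"
    using common_functional by blast
  then obtain num den where *: "poly den 0 \<noteq> 0" "poly den 1 \<noteq> 0"
    "curve_point num den 0 = p" "curve_point num den 1 = q"
    "\<And>s. poly den s \<noteq> 0 \<Longrightarrow> jac (curve_point num den s) = (1 - s) *s jac p + s *s jac q"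
    using curve_exists by metis
  have "curve_point num den s \<in> jac_locus I w" if "poly den s \<noteq> 0" for s
    using p q by (auto simp: jac_locus_def *(5)[OF that] algebra_simps)
  with * show "\<exists>num den. poly den 0 \<noteq> 0 \<and> poly den 1 \<noteq> 0 \<and> curve_point num den 0 = p \<and>
      curve_point num den 1 = q \<and> (\<forall>s. poly den s \<noteq> 0 \<longrightarrow> curve_point num den s \<in> jac_locus I w)"
    by blast
qed

section \<open>Ideals and regular sequences\<close>

interpretation ideal: Modules.module "(*) :: 'r::comm_ring_1 \<Rightarrow> 'r \<Rightarrow> 'r"
  by unfold_locales (simp_all add: algebra_simps)

text \<open>In a ring this rule moves brackets to the left, against \<^term>\<open>a * (b * c)\<close> as normal form; with
  both orientations the simplifier would loop.\<close>

declare ideal.scale_scale [simp del]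

lemma regular_sequence_Nil: "regular_sequence ([] :: 'r::comm_ring_1 list)"
proof -
  have "{0::'r} \<noteq> UNIV"
    using zero_neq_one[where 'a = 'r] by (metis UNIV_I singletonD)
  then show ?thesis
    unfolding regular_sequence_def by (auto simp: ideal.span_empty)
qed

lemma regular_sequence_snoc:
  assumes fs: "regular_sequence fs" and proper: "ideal_gen (set (fs @ [g])) \<noteq> UNIV"
    and g: "\<And>f. g * f \<in> ideal_gen (set fs) \<Longrightarrow> f \<in> ideal_gen (set fs)"
  shows "regular_sequence (fs @ [g])"
  unfolding regular_sequence_def
proof (intro conjI proper allI impI)
  fix i f assume "i < length (fs @ [g])"
    and *: "(fs @ [g]) ! i * f \<in> ideal_gen (set (take i (fs @ [g])))"
  then consider "i < length fs" | "i = length fs" by fastforce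
  then show "f \<in> ideal_gen (set (take i (fs @ [g])))"
  proof cases
    case 1
    then show ?thesis
      using fs * unfolding regular_sequence_def by (simp add: nth_append)
  next
    case 2
    then show ?thesis using g[of f] * by simp
  qed
qed

text \<open>
  If membership of all \<open>D i * g\<close> implies membership of \<open>g\<close>, the exponents can be lowered one at a time: each
  \<open>D i * g\<close> satisfies the assumption with a smaller exponent at \<open>i\<close>.
\<close>

lemma saturated_idealD:
  fixes D :: "'i::finite \<Rightarrow> 'r::comm_ring_1"
  assumes J: "ideal.subspace J" and sat: "\<And>g. (\<And>i. D i * g \<in> J) \<Longrightarrow> g \<in> J"
    and "\<And>i. D i ^ n i * g \<in> J"
  shows "g \<in> J"
  using assms(3)
proof (induction "sum n UNIV" arbitrary: n g rule: less_induct)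
  case less
  show ?case
  proof (cases "\<exists>i. n i = 0")
    case True
    then show ?thesis using less.prems by (metis mult_1 power_0)
  next
    case False
    show ?thesis
    proof (rule sat)
      fix i
      have pos: "n i \<noteq> 0" using False by simp
      show "D i * g \<in> J"
      proof (rule less.hyps)
        show "sum (n(i := n i - 1)) UNIV < sum n UNIV"
          using False by (intro sum_strict_mono_ex1 bexI[of _ i]) auto
        show "D j ^ (n(i := n i - 1)) j * (D i * g) \<in> J" for j
        proof (cases "j = i")
          case True
          have "D i ^ (n i - 1) * (D i * g) = D i ^ n i * g"
            using pos by (cases "n i") (auto simp: algebra_simps)
          then show ?thesis using True less.prems[of i] by simp
        next
          case False
          have "D i * (D j ^ n j * g) \<in> J"
            using ideal.subspace_scale[OF J] less.prems by blast
          then show ?thesis using False by (simp add: algebra_simps)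
        qed
      qed
    qed
  qed
qed

lemma (in coefficient_map) h_power: "h (c ^ n) = h c ^ n"
  by (induction n) auto

lemma (in coefficient_map) subspace_vanishing_ideal:
  "ideal.subspace (vanishing_ideal_over h S)"
  by (auto simp: ideal.subspace_def vanishing_ideal_over_def)

lemma (in coefficient_map) coefficient_map_eval: "coefficient_map (eval_mpoly_over h a)"
  by unfold_locales auto

section \<open>The ideal of a Jacobi locus\<close>

text \<open>
  The point whose coordinates are the variables. Formulas for brackets, applied to it, give polynomials.
\<close>

definition generic :: "('n::finite, 'k::comm_ring_1) mpoly ^ 'n"
  where "generic = (\<chi> i. mvar i)"

definition jac_poly :: "'k::comm_ring_1 ^ 3 \<Rightarrow> 3 \<Rightarrow> (9, 'k) mpoly"
  where "jac_poly w i = jac generic $ i - mconst (w $ i)"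

lemma sym_point_in:
  assumes "ideal.subspace J" "\<And>i j. C i j \<in> J"
  shows "sym_point C $ k \<in> J"
  using exhaust_9[of k] assms ideal.subspace_neg[OF assms(1) assms(2)]
  by (elim disjE) simp_all

text \<open>
  The correction is linear in \<open>r\<close>.
\<close>

lemma correction_in:
  assumes J: "ideal.subspace J" and r: "\<And>i. r $ i \<in> J"
  shows "correction u r t $ k \<in> J"
proof -
  have scale: "x * (r $ i) \<in> J" "(r $ i) * x \<in> J" for x i
    using ideal.subspace_scale[OF J r] by (simp_all add: mult.commute)
  have rt: "dot r t \<in> J"
    unfolding dot_def by (intro ideal.subspace_add[OF J] scale)
  have "dot u t * (u $ i * r $ j + r $ i * u $ j) - dot r t * (u $ i * u $ j) \<in> J" for i j
  proof (rule ideal.subspace_diff[OF J])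
    show "dot u t * (u $ i * r $ j + r $ i * u $ j) \<in> J"
      by (rule ideal.subspace_scale[OF J]) (intro ideal.subspace_add[OF J] scale)
    show "dot r t * (u $ i * u $ j) \<in> J"
      by (subst mult.commute) (rule ideal.subspace_scale[OF J rt])
  qed
  then show ?thesis unfolding correction_def by (rule sym_point_in[OF J])
qed

context coefficient_map
begin

lemma vmap_eval_generic: "vmap (eval_mpoly_over h a) generic = a"
  by (simp add: generic_def vec_eq_iff)

lemma eval_jac: "eval_mpoly_over h a (jac generic $ i) = jac a $ i"
  using coefficient_map.vmap_jac[OF coefficient_map_eval, where p=generic, of a]
  by (simp add: vec_eq_iff vmap_eval_generic)

lemma eval_tvec: "eval_mpoly_over h a (tvec generic $ i) = tvec a $ i"
  using coefficient_map.vmap_tvec[OF coefficient_map_eval, where p=generic, of a]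
  by (simp add: vec_eq_iff vmap_eval_generic)

lemma eval_jac_poly: "eval_mpoly_over h a (jac_poly w i) = jac a $ i - h (w $ i)"
  by (simp add: jac_poly_def eval_jac)

end

context infinite_extension
begin

text \<open>
  Correcting the entries of the Jacobi vector in \<open>I\<close> retracts the open set \<open>t\<^sub>i \<noteq> 0\<close> onto the locus. With \<open>u\<close> the
  \<open>i\<close>-th unit vector the denominator is \<open>t\<^sub>i\<^sup>2\<close>, and the numerators lie in \<open>J\<close>. So the composition of \<open>g\<close> with the
  retraction becomes, after multiplication by a power of \<open>t\<^sub>i\<close>, a polynomial congruent to that power times \<open>g\<close>.
\<close>

lemma retraction_lift:
  fixes w :: "'k ^ 3" and g :: "(9, 'k) mpoly" and I :: "3 set"
  defines "J \<equiv> ideal_gen (jac_poly w ` I)"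
    and "r \<equiv> \<lambda>p. (\<chi> j. if j \<in> I then h (w $ j) - jac p $ j else 0)"
  shows "\<exists>N G. G - tvec generic $ i ^ N * g \<in> J \<and>
    (\<forall>p. tvec p $ i \<noteq> 0 \<longrightarrow> eval_mpoly_over h p G = (tvec p $ i) ^ N *
       eval_mpoly_over h (p + inverse ((tvec p $ i)\<^sup>2) *s correction (axis i 1) (r p) (tvec p)) g)"
proof -
  let ?D = "tvec generic $ i :: (9, 'k) mpoly" and ?e = "eval_mpoly_over h"
  let ?\<pi> = "\<lambda>p. p + inverse ((tvec p $ i)\<^sup>2) *s correction (axis i 1) (r p) (tvec p)"
  note scaleJ = ideal.span_scale[of _ "jac_poly w ` I", folded J_def]
  note addJ = ideal.span_add[of _ "jac_poly w ` I", folded J_def]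
  show ?thesis
  proof (induction g rule: mpoly_induct)
    case (const c)
    show ?case
      by (intro exI[of _ 0] exI[of _ "mconst c"]) (simp add: J_def ideal.span_zero)
  next
    case (var k)
    define R :: "(9, 'k) mpoly ^ 3"
      where "R = (\<chi> j. if j \<in> I then mconst (w $ j) - jac generic $ j else 0)"
    let ?C = "correction (axis i 1) R (tvec generic)"
    have "- jac_poly w j \<in> J" if "j \<in> I" for j
      using that unfolding J_def by (intro ideal.span_neg ideal.span_base imageI)
    then have "R $ j \<in> J" for j
      by (auto simp: R_def jac_poly_def J_def ideal.span_zero)
    then have "?C $ k \<in> J"
      using correction_in[OF ideal.subspace_span, of R] by (simp add: J_def)
    moreover have "?e p (?D ^ 2 * mvar k + ?C $ k) = (tvec p $ i) ^ 2 * ?e (?\<pi> p) (mvar k)"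
      if "tvec p $ i \<noteq> 0" for p
    proof -
      have "vmap (?e p) R = r p"
        by (simp add: R_def r_def vec_eq_iff eval_jac)
      moreover have "vmap (?e p) (axis i 1) = axis i 1"
        by (simp add: vec_eq_iff axis_def)
      moreover have "vmap (?e p) (tvec generic) = tvec p"
        by (simp add: vec_eq_iff eval_tvec)
      ultimately have "vmap (?e p) ?C = correction (axis i 1) (r p) (tvec p)"
        by (simp only: coefficient_map.vmap_correction[OF coefficient_map_eval])
      then have "vmap (?e p) ?C $ k = correction (axis i 1) (r p) (tvec p) $ k"
        by (rule arg_cong)
      then have "?e p (?C $ k) = correction (axis i 1) (r p) (tvec p) $ k"
        by (simp only: vmap_nth)
      then show ?thesis
        using that
        by (simp add: eval_tvec field_simps)
    qed
    ultimately show ?case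
      by (intro exI[of _ 2] exI[of _ "?D ^ 2 * mvar k + ?C $ k"]) auto
  next
    case (add f g)
    then obtain N M F G where *: "F - ?D ^ N * f \<in> J" "G - ?D ^ M * g \<in> J"
      "\<And>p. tvec p $ i \<noteq> 0 \<Longrightarrow> ?e p F = (tvec p $ i) ^ N * ?e (?\<pi> p) f"
      "\<And>p. tvec p $ i \<noteq> 0 \<Longrightarrow> ?e p G = (tvec p $ i) ^ M * ?e (?\<pi> p) g"
      by blast
    have "?D ^ M * (F - ?D ^ N * f) + ?D ^ N * (G - ?D ^ M * g) \<in> J"
      by (rule addJ[OF scaleJ scaleJ]) (rule *)+
    then have "?D ^ M * F + ?D ^ N * G - ?D ^ (N + M) * (f + g) \<in> J"
      by (simp add: algebra_simps power_add)
    then show ?case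
      by (intro exI[of _ "N + M"] exI[of _ "?D ^ M * F + ?D ^ N * G"])
         (auto simp: *(3,4) eval_tvec power_add algebra_simps)
  next
    case (mult f g)
    then obtain N M F G where *: "F - ?D ^ N * f \<in> J" "G - ?D ^ M * g \<in> J"
      "\<And>p. tvec p $ i \<noteq> 0 \<Longrightarrow> ?e p F = (tvec p $ i) ^ N * ?e (?\<pi> p) f"
      "\<And>p. tvec p $ i \<noteq> 0 \<Longrightarrow> ?e p G = (tvec p $ i) ^ M * ?e (?\<pi> p) g"
      by blast
    have "G * (F - ?D ^ N * f) + (?D ^ N * f) * (G - ?D ^ M * g) \<in> J"
      by (rule addJ[OF scaleJ scaleJ]) (rule *)+
    then have "F * G - ?D ^ (N + M) * (f * g) \<in> J"
      by (simp add: algebra_simps power_add)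
    then show ?case
      by (intro exI[of _ "N + M"] exI[of _ "F * G"])
         (auto simp: *(3,4) eval_tvec power_add algebra_simps)
  qed
qed

text \<open>
  If \<open>g\<close> vanishes on the locus, then the polynomial \<open>G\<close> from the retraction vanishes where \<open>t\<^sub>i \<noteq> 0\<close>, hence
  \<open>t\<^sub>i G = 0\<close>, and \<open>J\<close> contains the product of \<open>g\<close> and a power of \<open>t\<^sub>i\<close>. Moreover \<open>J\<close> is saturated: modulo \<open>J\<close>, the
  nonzero constant \<open>w\<^sub>i\<^sub>0\<close> equals the \<open>i0\<close>-th entry of \<open>M t\<close>, a combination of \<open>t\<^sub>1, t\<^sub>2, t\<^sub>3\<close>.
\<close>

theorem vanishing_ideal_jac_locus:
  fixes w :: "'k ^ 3"
  assumes "i0 \<in> I" "w $ i0 \<noteq> 0"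
  shows "vanishing_ideal_over h (jac_locus I (vmap h w)) = ideal_gen (jac_poly w ` I)"
proof
  let ?J = "ideal_gen (jac_poly w ` I)" and ?Z = "jac_locus I (vmap h w)"
  let ?D = "\<lambda>i. tvec generic $ i :: (9, 'k) mpoly"
  show "?J \<subseteq> vanishing_ideal_over h ?Z"
    by (rule ideal.span_minimal[OF _ subspace_vanishing_ideal])
       (auto simp: vanishing_ideal_over_def jac_locus_def eval_jac_poly)
  show "vanishing_ideal_over h ?Z \<subseteq> ?J"
  proof
    fix g assume g: "g \<in> vanishing_ideal_over h ?Z"
    have "\<exists>N. ?D i ^ N * g \<in> ?J" for i
    proof -
      let ?r = "\<lambda>p. (\<chi> j. if j \<in> I then h (w $ j) - jac p $ j else 0)"
      let ?\<pi> = "\<lambda>p. p + inverse ((tvec p $ i)\<^sup>2) *s correction (axis i 1) (?r p) (tvec p)"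
      obtain N G where G: "G - ?D i ^ N * g \<in> ?J"
        "\<And>p. tvec p $ i \<noteq> 0 \<Longrightarrow> eval_mpoly_over h p G = (tvec p $ i) ^ N * eval_mpoly_over h (?\<pi> p) g"
        using retraction_lift[of i g w I] by blast
      have "eval_mpoly_over h p (?D i * G) = 0" for p
      proof (cases "tvec p $ i = 0")
        case False
        then have "jac (?\<pi> p) = jac p + ?r p"
          by (intro jac_add_correction) (simp add: dot_axis)
        then have "?\<pi> p \<in> ?Z" by (simp add: jac_locus_def)
        then have "eval_mpoly_over h (?\<pi> p) g = 0"
          using g unfolding vanishing_ideal_over_def by blast
        then show ?thesis using G(2)[OF False] by simp
      qed (simp add: eval_tvec)
      then have "?D i * G = 0" by (rule mpoly_eq_0I)
      moreover have "?D i ^ Suc N * g = ?D i * G - ?D i * (G - ?D i ^ N * g)"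
        by (simp only: right_diff_distrib power_Suc mult.assoc diff_diff_eq2 add_diff_cancel_left')
      moreover have "0 - ?D i * (G - ?D i ^ N * g) \<in> ?J"
        by (intro ideal.span_diff ideal.span_zero ideal.span_scale G(1))
      ultimately show ?thesis by metis
    qed
    then obtain n where n: "?D i ^ n i * g \<in> ?J" for i by metis
    show "g \<in> ?J"
    proof (rule saturated_idealD[OF ideal.subspace_span _ n])
      fix f assume f: "?D i * f \<in> ?J" for i
      have "jac generic $ i0 * f \<in> ?J"
      proof -
        have "\<exists>x y z. jac generic $ i0 = x * ?D 1 + y * ?D 2 + z * ?D 3"
        proof -
          have jac: "jac p $ 1 = p $ 7 * tvec p $ 1 + (- p $ 4) * tvec p $ 2 + p $ 1 * tvec p $ 3"
            "jac p $ 2 = p $ 8 * tvec p $ 1 + (- p $ 5) * tvec p $ 2 + p $ 2 * tvec p $ 3"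
            "jac p $ 3 = p $ 9 * tvec p $ 1 + (- p $ 6) * tvec p $ 2 + p $ 3 * tvec p $ 3"
            for p :: "(9, 'k) mpoly ^ 9"
            by (simp_all add: jac_def)
          consider "i0 = 1" | "i0 = 2" | "i0 = 3" using exhaust_3 by blast
          then show ?thesis by cases (use jac[of generic] in blast)+
        qed
        then obtain x y z where "jac generic $ i0 = x * ?D 1 + y * ?D 2 + z * ?D 3" by blast
        then have "jac generic $ i0 * f = x * (?D 1 * f) + y * (?D 2 * f) + z * (?D 3 * f)"
          by (simp add: algebra_simps)
        moreover have "x * (?D 1 * f) + y * (?D 2 * f) + z * (?D 3 * f) \<in> ?J"
          by (intro ideal.span_add ideal.span_scale f)
        ultimately show ?thesis by simp
      qed
      moreover have "f * jac_poly w i0 \<in> ?J"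
        using assms by (intro ideal.span_scale ideal.span_base) auto
      ultimately have "mconst (inverse (w $ i0)) * (jac generic $ i0 * f - f * jac_poly w i0) \<in> ?J"
        by (rule ideal.span_scale[OF ideal.span_diff])
      moreover have "mconst (inverse (w $ i0)) * mconst (w $ i0) = (1 :: (9, 'k) mpoly)"
        using assms by (simp add: mconst_def mult_single)
      then have "mconst (inverse (w $ i0)) * (jac generic $ i0 * f - f * jac_poly w i0) = f"
        by (simp add: jac_poly_def algebra_simps)
      ultimately show "f \<in> ?J" by simp
    qed
  qed
qed

end

section \<open>Finite point sets are complete intersections\<close>

lemma rationally_connected_affine:
  fixes S :: "('f::field ^ 'n) set"
  assumes "\<And>p q s. p \<in> S \<Longrightarrow> q \<in> S \<Longrightarrow> (1 - s) *s p + s *s q \<in> S"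
  shows "rationally_connected S"
  unfolding rationally_connected_def
proof (intro ballI exI conjI allI impI)
  fix p q assume pq: "p \<in> S" "q \<in> S"
  have pt: "curve_point (segment p q) 1 s = (1 - s) *s p + s *s q" for s
    using segment_at[of s p q] by (simp add: curve_point_def vec_eq_iff)
  show "curve_point (segment p q) 1 0 = p" "curve_point (segment p q) 1 1 = q"
    "\<And>s. curve_point (segment p q) 1 s \<in> S"
    using pq assms by (simp_all add: pt)
qed simp_all

context infinite_extension
begin

text \<open>
  Points over \<open>f\<close> whose coordinates in \<open>V\<close> agree with those of \<open>a\<close>. As \<open>V\<close> grows, the union of the cylinders over a
  set \<open>A\<close> shrinks from the whole space to \<open>A\<close>.
\<close>

definition cylinder :: "'n::finite set \<Rightarrow> 'k ^ 'n \<Rightarrow> ('f ^ 'n) set"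
  where "cylinder V a = {p. \<forall>i\<in>V. p $ i = h (a $ i)}"

lemma rationally_connected_cylinder: "rationally_connected (cylinder V a)"
  by (rule rationally_connected_affine) (auto simp: cylinder_def algebra_simps)

text \<open>
  Division by \<open>x\<^sub>v - c\<close>, the remainder being the result of substituting \<open>c\<close> for \<open>x\<^sub>v\<close>. It is stated in terms of
  values, since that is how cylinders see polynomials.
\<close>

lemma mpoly_split_root:
  fixes f :: "('n::finite, 'k) mpoly"
  shows "\<exists>q r. \<forall>p. eval_mpoly_over h p f = (p $ v - h c) * eval_mpoly_over h p q + eval_mpoly_over h p r \<and>
    eval_mpoly_over h p r = eval_mpoly_over h (\<chi> i. if i = v then h c else p $ i) f"
proof (induction f rule: mpoly_induct)
  case (const d)
  show ?case by (rule exI[of _ 0], rule exI[of _ "mconst d"]) simp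
next
  case (var i)
  show ?case
  proof (cases "i = v")
    case True
    show ?thesis by (rule exI[of _ 1], rule exI[of _ "mconst c"]) (simp add: True)
  next
    case False
    show ?thesis by (rule exI[of _ 0], rule exI[of _ "mvar i"]) (simp add: False)
  qed
next
  case (add f g)
  then obtain q r q' r' where
    "\<forall>p. eval_mpoly_over h p f = (p $ v - h c) * eval_mpoly_over h p q + eval_mpoly_over h p r \<and>
      eval_mpoly_over h p r = eval_mpoly_over h (\<chi> i. if i = v then h c else p $ i) f"
    "\<forall>p. eval_mpoly_over h p g = (p $ v - h c) * eval_mpoly_over h p q' + eval_mpoly_over h p r' \<and>
      eval_mpoly_over h p r' = eval_mpoly_over h (\<chi> i. if i = v then h c else p $ i) g"
    by blast
  then have
    f: "\<And>p. eval_mpoly_over h p f = (p $ v - h c) * eval_mpoly_over h p q + eval_mpoly_over h p r"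
      "\<And>p. eval_mpoly_over h p r = eval_mpoly_over h (\<chi> i. if i = v then h c else p $ i) f"
    and g: "\<And>p. eval_mpoly_over h p g = (p $ v - h c) * eval_mpoly_over h p q' + eval_mpoly_over h p r'"
      "\<And>p. eval_mpoly_over h p r' = eval_mpoly_over h (\<chi> i. if i = v then h c else p $ i) g"
    by blast+
  have "eval_mpoly_over h p (f + g)
      = (p $ v - h c) * eval_mpoly_over h p (q + q') + eval_mpoly_over h p (r + r')" for p
    by (simp add: f(1) g(1) algebra_simps)
  moreover have "eval_mpoly_over h p (r + r')
      = eval_mpoly_over h (\<chi> i. if i = v then h c else p $ i) (f + g)" for p
    by (simp add: f(2) g(2))
  ultimately show ?case by blast
next
  case (mult f g)
  then obtain q r q' r' where
    "\<forall>p. eval_mpoly_over h p f = (p $ v - h c) * eval_mpoly_over h p q + eval_mpoly_over h p r \<and>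
      eval_mpoly_over h p r = eval_mpoly_over h (\<chi> i. if i = v then h c else p $ i) f"
    "\<forall>p. eval_mpoly_over h p g = (p $ v - h c) * eval_mpoly_over h p q' + eval_mpoly_over h p r' \<and>
      eval_mpoly_over h p r' = eval_mpoly_over h (\<chi> i. if i = v then h c else p $ i) g"
    by blast
  then have
    f: "\<And>p. eval_mpoly_over h p f = (p $ v - h c) * eval_mpoly_over h p q + eval_mpoly_over h p r"
      "\<And>p. eval_mpoly_over h p r = eval_mpoly_over h (\<chi> i. if i = v then h c else p $ i) f"
    and g: "\<And>p. eval_mpoly_over h p g = (p $ v - h c) * eval_mpoly_over h p q' + eval_mpoly_over h p r'"
      "\<And>p. eval_mpoly_over h p r' = eval_mpoly_over h (\<chi> i. if i = v then h c else p $ i) g"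
    by blast+
  have "eval_mpoly_over h p (f * g)
      = (p $ v - h c) * eval_mpoly_over h p (q * g + r * q') + eval_mpoly_over h p (r * r')" for p
    by (simp add: f(1) g(1) algebra_simps)
  moreover have "eval_mpoly_over h p (r * r')
      = eval_mpoly_over h (\<chi> i. if i = v then h c else p $ i) (f * g)" for p
    by (simp add: f(2) g(2))
  ultimately show ?case by blast
qed

text \<open>
  On a cylinder in the remaining variables, a polynomial with prescribed roots in \<open>x\<^sub>v\<close> is divisible by the product
  of the corresponding linear factors; they are split off one at a time.
\<close>

lemma divide_by_roots_on_cylinder:
  fixes f :: "('n::finite, 'k) mpoly"
  assumes "finite C" "v \<notin> V"
    and "\<And>p c. p \<in> cylinder V a \<Longrightarrow> c \<in> C \<Longrightarrow> p $ v = h c \<Longrightarrow> eval_mpoly_over h p f = 0"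
  shows "\<exists>q. \<forall>p\<in>cylinder V a. eval_mpoly_over h p f = (\<Prod>c\<in>C. p $ v - h c) * eval_mpoly_over h p q"
  using assms(1,3)
proof (induction C rule: finite_induct)
  case empty
  show ?case by (rule exI[of _ f]) simp
next
  case (insert c C)
  have "\<exists>q. \<forall>p\<in>cylinder V a. eval_mpoly_over h p f = (\<Prod>c\<in>C. p $ v - h c) * eval_mpoly_over h p q"
    by (rule insert.IH) (use insert.prems in blast)
  then obtain q where q: "\<And>p. p \<in> cylinder V a \<Longrightarrow>
      eval_mpoly_over h p f = (\<Prod>c\<in>C. p $ v - h c) * eval_mpoly_over h p q"
    by blast
  obtain q' r where r:
    "\<And>p. eval_mpoly_over h p q = (p $ v - h c) * eval_mpoly_over h p q' + eval_mpoly_over h p r"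
    "\<And>p. eval_mpoly_over h p r = eval_mpoly_over h (\<chi> i. if i = v then h c else p $ i) q"
    using mpoly_split_root[where v = v and c = c and f = q] by blast
  have "eval_mpoly_over h p r = 0" if "p \<in> cylinder V a" for p
  proof -
    let ?p = "\<chi> i. if i = v then h c else p $ i"
    have "?p \<in> cylinder V a" using that assms(2) by (auto simp: cylinder_def)
    then have "(\<Prod>d\<in>C. ?p $ v - h d) * eval_mpoly_over h ?p q = 0"
      using insert.prems[of ?p c] q by simp
    then show ?thesis using insert.hyps by (auto simp: r(2) prod_zero_iff)
  qed
  then show ?case
    using insert.hyps by (intro exI[of _ q']) (auto simp: q r(1))
qed

text \<open>
  A Lagrange interpolation polynomial in the variables of \<open>V\<close>.
\<close>

lemma separator_exists:
  fixes A :: "('k ^ 'n::finite) set" and a :: "'k ^ 'n"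
  assumes "finite A"
  obtains L :: "('n, 'k) mpoly" where "\<And>b p. b \<in> A \<Longrightarrow> p \<in> cylinder V b \<Longrightarrow>
    eval_mpoly_over h p L = (if \<forall>i\<in>V. b $ i = a $ i then 1 else 0)"
proof
  let ?C = "\<lambda>i. (\<lambda>b. b $ i) ` A - {a $ i}"
  let ?L = "(\<Prod>i\<in>V. \<Prod>c\<in>?C i. mconst (inverse (a $ i - c)) * (mvar i - mconst c)) :: ('n, 'k) mpoly"
  fix b p assume b: "b \<in> A" and p: "p \<in> cylinder V b"
  have "eval_mpoly_over h p ?L = (\<Prod>i\<in>V. \<Prod>c\<in>?C i. h (inverse (a $ i - c) * (b $ i - c)))"
    using p by (auto simp: eval_prod cylinder_def intro!: prod.cong)
  also have "\<dots> = (if \<forall>i\<in>V. b $ i = a $ i then 1 else 0)"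
  proof (cases "\<forall>i\<in>V. b $ i = a $ i")
    case True
    have "(\<Prod>c\<in>?C i. h (inverse (a $ i - c) * (b $ i - c))) = 1" if "i \<in> V" for i
    proof (rule prod.neutral, rule ballI)
      fix c assume "c \<in> ?C i"
      then have "inverse (a $ i - c) * (b $ i - c) = 1" using True that by auto
      then show "h (inverse (a $ i - c) * (b $ i - c)) = 1" by (simp only: h_1)
    qed
    then show ?thesis using True by simp
  next
    case False
    then obtain i where i: "i \<in> V" "b $ i \<noteq> a $ i" by blast
    then have "(\<Prod>c\<in>?C i. h (inverse (a $ i - c) * (b $ i - c))) = 0"
      using b assms by (intro prod_zero) (auto intro!: bexI[of _ "b $ i"])
    then have "(\<Prod>i\<in>V. \<Prod>c\<in>?C i. h (inverse (a $ i - c) * (b $ i - c))) = 0"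
      using i by (intro prod_zero) auto
    then show ?thesis using False by auto
  qed
  finally show "eval_mpoly_over h p ?L = (if \<forall>i\<in>V. b $ i = a $ i then 1 else 0)" .
qed

lemma vanishing_ideal_UNIV: "vanishing_ideal_over h (UNIV :: ('f ^ 'n::finite) set) = {0}"
  using mpoly_eq_0I by (auto simp: vanishing_ideal_over_def)

text \<open>
  One variable at a time. For each \<open>a\<close> in the projection of \<open>A\<close> to the coordinates in \<open>V\<close>, let \<open>B a\<close> be the finite set
  of \<open>v\<close>-coordinates of points of \<open>A\<close> above \<open>a\<close>. The new generator \<open>g\<close> interpolates the polynomials
  \<open>\<Prod>\<^bsub>c\<in>B a\<^esub> (x\<^sub>v - c)\<close>: it agrees with the one for \<open>a\<close> on the cylinder over \<open>a\<close>. A polynomial that vanishes on the smaller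
  union is divisible on each cylinder by that product, and the quotients can be interpolated as well. The
  vanishing ideal of a single cylinder is prime and does not contain \<open>g\<close>, so \<open>g\<close> is regular.
\<close>

lemma complete_intersection_cylinders:
  fixes A :: "('k ^ 'n::finite) set"
  assumes A: "finite A" "A \<noteq> {}" and "finite V"
  shows "\<exists>fs. regular_sequence fs \<and> ideal_gen (set fs) = vanishing_ideal_over h (\<Union>a\<in>A. cylinder V a)"
  using \<open>finite V\<close>
proof (induction V rule: finite_induct)
  case empty
  have "(\<Union>a\<in>A. cylinder {} a) = UNIV" using A by (auto simp: cylinder_def)
  then show ?case
    using regular_sequence_Nil by (intro exI[of _ "[]"]) (simp add: ideal.span_empty vanishing_ideal_UNIV)
next
  case (insert v V)
  let ?e = "eval_mpoly_over h"
  define Y where "Y V = (\<Union>a\<in>A. cylinder V a)" for V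
  obtain fs where fs: "regular_sequence fs" "ideal_gen (set fs) = vanishing_ideal_over h (Y V)"
    using insert.IH unfolding Y_def by blast
  \<comment> \<open>one representative for each class of points of \<open>A\<close> with the same coordinates in \<open>V\<close>\<close>
  define pr where "pr a = (\<chi> i. if i \<in> V then a $ i else 0)" for a :: "'k ^ 'n"
  define B where "B a = (\<lambda>b. b $ v) ` {b \<in> A. \<forall>i\<in>V. b $ i = a $ i}" for a
  have finB: "finite (B a)" for a using A by (simp add: B_def)
  have pr: "(\<forall>i\<in>V. b $ i = a $ i) \<longleftrightarrow> a = pr b" if "a \<in> pr ` A" for a b
    using that by (auto simp: pr_def vec_eq_iff)
  have cylinder_pr: "cylinder V (pr a) = cylinder V a" and B_pr: "B (pr a) = B a" for a
    by (auto simp: cylinder_def pr_def B_def)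
  have "\<exists>L. \<forall>b p. b \<in> A \<longrightarrow> p \<in> cylinder V b \<longrightarrow>
      ?e p L = (if \<forall>i\<in>V. b $ i = a $ i then 1 else 0)" for a
    using separator_exists[OF A(1), of V a] by metis
  then obtain L where L: "?e p (L a) = (if \<forall>i\<in>V. b $ i = a $ i then 1 else 0)"
    if "b \<in> A" "p \<in> cylinder V b" for a b p by metis
  have glue: "?e p (\<Sum>a\<in>pr ` A. L a * F a) = ?e p (F (pr b))"
    if "b \<in> A" "p \<in> cylinder V b" for b p and F :: "'k ^ 'n \<Rightarrow> ('n, 'k) mpoly"
  proof -
    have "?e p (\<Sum>a\<in>pr ` A. L a * F a) = (\<Sum>a\<in>pr ` A. if a = pr b then ?e p (F a) else 0)"
      using that pr by (auto simp: eval_sum L intro!: sum.cong)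
    also have "\<dots> = ?e p (F (pr b))" using A that by simp
    finally show ?thesis .
  qed
  define g where "g = (\<Sum>a\<in>pr ` A. L a * (\<Prod>c\<in>B a. mvar v - mconst c))"
  have g: "?e p g = (\<Prod>c\<in>B b. p $ v - h c)" if "b \<in> A" "p \<in> cylinder V b" for b p
    unfolding g_def using glue[OF that] by (simp add: eval_prod B_pr)
  have sub: "vanishing_ideal_over h (Y V) \<subseteq> vanishing_ideal_over h (Y (insert v V))"
    by (auto simp: vanishing_ideal_over_def Y_def cylinder_def)
  have g_in: "g \<in> vanishing_ideal_over h (Y (insert v V))"
  proof -
    have "?e p g = 0" if "b \<in> A" "p \<in> cylinder (insert v V) b" for b p
    proof -
      have "p \<in> cylinder V b" "p $ v = h (b $ v)" "b $ v \<in> B b"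
        using that by (auto simp: cylinder_def B_def)
      then show ?thesis using g[OF that(1)] finB by (auto simp: prod_zero_iff)
    qed
    then show ?thesis by (auto simp: vanishing_ideal_over_def Y_def)
  qed
  have ideal: "ideal_gen (set (fs @ [g])) = vanishing_ideal_over h (Y (insert v V))" (is "?J = ?I")
  proof
    show "?J \<subseteq> ?I"
      using sub fs(2) g_in ideal.span_superset[of "set fs"]
      by (intro ideal.span_minimal[OF _ subspace_vanishing_ideal]) auto
    show "?I \<subseteq> ?J"
    proof
      fix f assume f: "f \<in> ?I"
      have "\<exists>q. \<forall>p\<in>cylinder V a. ?e p f = (\<Prod>c\<in>B a. p $ v - h c) * ?e p q" for a
      proof (rule divide_by_roots_on_cylinder[OF finB insert.hyps(2)])
        fix p c assume "p \<in> cylinder V a" "c \<in> B a" "p $ v = h c"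
        then have "p \<in> Y (insert v V)" by (auto simp: B_def cylinder_def Y_def)
        then show "?e p f = 0" using f by (auto simp: vanishing_ideal_over_def)
      qed
      then obtain q where q: "?e p f = (\<Prod>c\<in>B a. p $ v - h c) * ?e p (q a)" if "p \<in> cylinder V a" for a p
        by metis
      let ?q = "\<Sum>a\<in>pr ` A. L a * q a"
      have "f - g * ?q \<in> vanishing_ideal_over h (Y V)"
        using g glue q[of _ "pr _"] by (auto simp: vanishing_ideal_over_def Y_def cylinder_pr B_pr)
      then have "f - g * ?q \<in> ?J"
        using fs(2) ideal.span_mono[of "set fs" "set (fs @ [g])"] by auto
      moreover have "?q * g \<in> ?J" by (intro ideal.span_scale ideal.span_base) simp
      ultimately have "(f - g * ?q) + ?q * g \<in> ?J" by (rule ideal.span_add)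
      then show "f \<in> ?J" by (simp add: mult.commute)
    qed
  qed
  have "regular_sequence (fs @ [g])"
  proof (rule regular_sequence_snoc[OF fs(1)])
    obtain b where "b \<in> A" using A by blast
    moreover have "(\<chi> i. h (b $ i)) \<in> cylinder (insert v V) b" by (simp add: cylinder_def)
    ultimately have "1 \<notin> vanishing_ideal_over h (Y (insert v V))"
      by (auto simp: vanishing_ideal_over_def Y_def)
    then show "ideal_gen (set (fs @ [g])) \<noteq> UNIV" unfolding ideal by blast
  next
    fix f assume gf: "g * f \<in> ideal_gen (set fs)"
    have "f \<in> vanishing_ideal_over h (cylinder V b)" if b: "b \<in> A" for b
    proof -
      have "g * f \<in> vanishing_ideal_over h (cylinder V b)"
        using gf b unfolding fs(2) by (auto simp: vanishing_ideal_over_def Y_def)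
      moreover have "g \<notin> vanishing_ideal_over h (cylinder V b)"
      proof -
        obtain x where x: "x \<notin> h ` B b"
          using infinite_field finB ex_new_if_finite by blast
        define p where "p = (\<chi> i. if i = v then x else h (b $ i))"
        have "p \<in> cylinder V b" using insert.hyps by (auto simp: p_def cylinder_def)
        moreover from this have "?e p g \<noteq> 0"
          using g[OF b] x finB by (auto simp: p_def prod_zero_iff)
        ultimately show ?thesis by (auto simp: vanishing_ideal_over_def)
      qed
      ultimately show ?thesis
        using vanishing_ideal_prime[OF rationally_connected_cylinder] by blast
    qed
    then show "f \<in> ideal_gen (set fs)"
      unfolding fs(2) by (auto simp: vanishing_ideal_over_def Y_def)
  qed
  with ideal show ?case unfolding Y_def by blast
qed

lemma eval_vmap: "eval_mpoly_over h (vmap h a) f = h (eval_mpoly a f)"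
  by (simp add: eval_mpoly_over_def h_sum h_prod h_power)

text \<open>
  For \<open>V\<close> the set of all variables the union of the cylinders is \<open>A\<close> itself.
\<close>

theorem complete_intersection_finite:
  fixes A :: "('k ^ 'n::finite) set"
  assumes "finite A" "A \<noteq> {}"
  shows "complete_intersection (vanishing_ideal A)"
proof -
  have "(\<Union>a\<in>A. cylinder UNIV a) = vmap h ` A"
    by (auto simp: cylinder_def vec_eq_iff image_iff)
  then have "vanishing_ideal_over h (\<Union>a\<in>A. cylinder UNIV a) = vanishing_ideal A"
    by (simp add: vanishing_ideal_over_def eval_vmap)
  then show ?thesis
    using complete_intersection_cylinders[OF assms, of UNIV] unfolding complete_intersection_def by auto
qed

end

section \<open>Irreducible closed sets\<close>

text \<open>
  Evaluation over the base field itself. The rules are stated separately because those for the coefficient map become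
  trivial equations such as \<^term>\<open>c + d = c + d\<close>, on which the simplifier loops.
\<close>

lemma coefficient_map_id: "coefficient_map (\<lambda>c::'a::comm_ring_1. c)"
  by unfold_locales simp_all

lemmas eval_mpoly_simps [simp] =
  coefficient_map.eval_0[OF coefficient_map_id]
  coefficient_map.eval_1[OF coefficient_map_id]
  coefficient_map.eval_const[OF coefficient_map_id]
  coefficient_map.eval_var[OF coefficient_map_id]
  coefficient_map.eval_add[OF coefficient_map_id]
  coefficient_map.eval_diff[OF coefficient_map_id]
  coefficient_map.eval_minus[OF coefficient_map_id]
  coefficient_map.eval_mult[OF coefficient_map_id]
  coefficient_map.eval_power[OF coefficient_map_id]

lemma infinite_extension_id:
  "infinite (UNIV :: 'f::field set) \<Longrightarrow> infinite_extension (\<lambda>c::'f. c)"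
  by unfold_locales simp_all

lemma zariski_closed_Int_zeros:
  assumes "zariski_closed S"
  shows "zariski_closed {a \<in> S. \<forall>f\<in>Q. eval_mpoly a f = 0}"
proof -
  obtain P where "S = {a. \<forall>f\<in>P. eval_mpoly a f = 0}"
    using assms unfolding zariski_closed_def by blast
  then have "{a \<in> S. \<forall>f\<in>Q. eval_mpoly a f = 0} = {a. \<forall>f\<in>P \<union> Q. eval_mpoly a f = 0}"
    by blast
  then show ?thesis unfolding zariski_closed_def by blast
qed

lemma zariski_closed_separate:
  assumes "zariski_closed Y" "p \<notin> Y"
  obtains f where "f \<in> vanishing_ideal Y" "eval_mpoly p f \<noteq> 0"
proof -
  obtain P where P: "Y = {a. \<forall>f\<in>P. eval_mpoly a f = 0}"
    using assms(1) unfolding zariski_closed_def by blast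
  then obtain f where "f \<in> P" "eval_mpoly p f \<noteq> 0" using assms(2) by blast
  with P that show ?thesis by (auto simp: vanishing_ideal_over_def)
qed

lemma irreducible_varietyI:
  fixes S :: "('f::field ^ 'n::finite) set"
  assumes inf: "infinite (UNIV :: 'f set)"
    and S: "zariski_closed S" "S \<noteq> {}" "rationally_connected S"
  shows "irreducible_variety S"
  unfolding irreducible_variety_def
proof (intro conjI S allI impI)
  fix Y Z assume *: "zariski_closed Y \<and> zariski_closed Z \<and> S = Y \<union> Z"
  show "S = Y \<or> S = Z"
  proof (rule ccontr)
    assume "\<not> ?thesis"
    then obtain p q where p: "p \<in> S" "p \<notin> Y" and q: "q \<in> S" "q \<notin> Z" using * by blast
    obtain f where f: "f \<in> vanishing_ideal Y" "eval_mpoly p f \<noteq> 0"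
      using zariski_closed_separate * p by blast
    obtain g where g: "g \<in> vanishing_ideal Z" "eval_mpoly q g \<noteq> 0"
      using zariski_closed_separate * q by blast
    have "f * g \<in> vanishing_ideal S"
      using f g * by (auto simp: vanishing_ideal_over_def)
    then show False
      using infinite_extension.vanishing_ideal_prime[OF infinite_extension_id[OF inf] S(3)] f g p q by (auto simp: vanishing_ideal_over_def)
  qed
qed

text \<open>
  If \<open>f g\<close> vanishes on \<open>Z\<close>, then \<open>Z\<close> is the union of its zero sets of \<open>f\<close> and of \<open>g\<close>.
\<close>

lemma irreducible_variety_prime:
  assumes Z: "irreducible_variety Z" and fg: "f * g \<in> vanishing_ideal Z"
  shows "f \<in> vanishing_ideal Z \<or> g \<in> vanishing_ideal Z"
proof -
  let ?V = "\<lambda>f. {a \<in> Z. \<forall>g\<in>{f}. eval_mpoly a g = 0}"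
  have "Z = ?V f \<union> ?V g"
    using fg by (auto simp: vanishing_ideal_over_def)
  moreover have "zariski_closed (?V f)" "zariski_closed (?V g)"
    using Z by (auto intro: zariski_closed_Int_zeros simp only: irreducible_variety_def)
  ultimately have "Z = ?V f \<or> Z = ?V g"
    using Z unfolding irreducible_variety_def by blast
  then show ?thesis unfolding vanishing_ideal_over_def by blast
qed

section \<open>Algebraically independent functions\<close>

definition exps :: "nat \<Rightarrow> nat \<Rightarrow> nat list set"
  where "exps n d = {e. set e \<subseteq> {..d} \<and> length e = n}"

lemma finite_exps: "finite (exps n d)"
  unfolding exps_def by (rule finite_lists_length_eq) simp

lemma exps_0 [simp]: "exps 0 d = {[]}"
  by (auto simp: exps_def)

lemma card_exps: "card (exps n d) = (d + 1) ^ n"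
  unfolding exps_def by (subst card_lists_length_eq) simp_all

lemma sum_exps_Suc:
  "(\<Sum>e\<in>exps (Suc n) d. F e) = (\<Sum>j\<le>d. \<Sum>e\<in>exps n d. F (j # e))"
proof -
  have "exps (Suc n) d = (\<lambda>(j, e). j # e) ` ({..d} \<times> exps n d)"
    by (auto simp: exps_def length_Suc_conv image_iff)
  moreover have "inj_on (\<lambda>(j, e). j # e) ({..d} \<times> exps n d)" by (auto simp: inj_on_def)
  ultimately show ?thesis
    by (simp add: sum.reindex sum.cartesian_product case_prod_unfold)
qed

fun power_product :: "'r::comm_ring_1 list \<Rightarrow> nat list \<Rightarrow> 'r" where
  "power_product (f # fs) (j # e) = f ^ j * power_product fs e"
| "power_product _ _ = 1"

text \<open>
  Independence is tested on relations with all exponents at most \<open>d\<close>, for every \<open>d\<close>; a bound on each exponent,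
  rather than on the degree, makes the number of power products an exact power.
\<close>

definition alg_indep_on :: "('f::field ^ 'n::finite) set \<Rightarrow> ('n, 'f) mpoly list \<Rightarrow> bool"
  where "alg_indep_on Z fs \<longleftrightarrow> (\<forall>d c.
    (\<Sum>e\<in>exps (length fs) d. mconst (c e) * power_product fs e) \<in> vanishing_ideal Z \<longrightarrow>
    (\<forall>e\<in>exps (length fs) d. c e = 0))"

lemma alg_indep_on_mono: "alg_indep_on Y fs \<Longrightarrow> Y \<subseteq> Z \<Longrightarrow> alg_indep_on Z fs"
  unfolding alg_indep_on_def vanishing_ideal_over_def by blast

text \<open>
  Sort a relation by powers of \<open>f\<close> as \<open>\<Sum>\<^sub>j f\<^sup>j H\<^sub>j = 0\<close> on \<open>Z\<close>. On \<open>Y\<close>, where \<open>f\<close> vanishes, it reduces to \<open>H\<^sub>0 = 0\<close>, so the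
  coefficients of \<open>H\<^sub>0\<close> are zero. Then \<open>f\<close> cancels on \<open>Z\<close>, and the argument repeats with \<open>H\<^sub>1\<close>.
\<close>

lemma alg_indep_on_Cons:
  fixes f :: "('n::finite, 'f::field) mpoly"
  assumes indep: "alg_indep_on Y fs" and "Y \<subseteq> Z"
    and prime: "\<And>f g. f * g \<in> vanishing_ideal Z \<Longrightarrow> f \<in> vanishing_ideal Z \<or> g \<in> vanishing_ideal Z"
    and f: "f \<in> vanishing_ideal Y" "f \<notin> vanishing_ideal Z"
  shows "alg_indep_on Z (f # fs)"
  unfolding alg_indep_on_def
proof (intro allI impI)
  fix d c
  let ?I = "vanishing_ideal Z"
  define H where "H j = (\<Sum>e\<in>exps (length fs) d. mconst (c (j # e)) * power_product fs e)" for j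
  assume "(\<Sum>e\<in>exps (length (f # fs)) d. mconst (c e) * power_product (f # fs) e) \<in> ?I"
  also have "(\<Sum>e\<in>exps (length (f # fs)) d. mconst (c e) * power_product (f # fs) e)
      = (\<Sum>j\<le>d. f ^ j * H j)"
    by (simp add: sum_exps_Suc H_def sum_distrib_left mult.left_commute)
  finally have rel: "(\<Sum>j\<le>d. f ^ j * H j) \<in> ?I" .
  have pow: "f ^ k \<notin> ?I" for k
  proof (induction k)
    case (Suc k)
    then show ?case using prime[of f "f ^ k"] f(2) by auto
  next
    case 0
    then show ?case using f(2) by (auto simp: vanishing_ideal_over_def)
  qed
  have zero: "\<forall>e\<in>exps (length fs) d. c (k # e) = 0" if "k \<le> d" for k
    using that
  proof (induction k rule: less_induct)
    case (less k)
    have H0: "H j = 0" if "j < k" for j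
      using less that by (auto simp: H_def mconst_def intro!: sum.neutral)
    define G where "G = (\<Sum>j\<in>{Suc k..d}. f ^ (j - Suc k) * H j)"
    have "(\<Sum>j\<le>d. f ^ j * H j) = (\<Sum>j\<in>{k..d}. f ^ j * H j)"
      by (rule sum.mono_neutral_right) (auto simp: H0)
    also have "\<dots> = f ^ k * H k + (\<Sum>j\<in>{Suc k..d}. f ^ j * H j)"
      using less.prems by (rule sum.atLeast_Suc_atMost)
    also have "(\<Sum>j\<in>{Suc k..d}. f ^ j * H j) = (\<Sum>j\<in>{Suc k..d}. f ^ k * (f * (f ^ (j - Suc k) * H j)))"
    proof (rule sum.cong)
      fix j assume "j \<in> {Suc k..d}"
      then have "j = k + Suc (j - Suc k)" by simp
      then have "f ^ j = f ^ k * (f * f ^ (j - Suc k))"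
        by (metis power_add power_Suc)
      then show "f ^ j * H j = f ^ k * (f * (f ^ (j - Suc k) * H j))"
        by (simp only: mult.assoc)
    qed simp
    also have "\<dots> = f ^ k * (f * G)"
      by (simp only: G_def sum_distrib_left)
    finally have "f ^ k * (H k + f * G) \<in> ?I"
      using rel by (simp add: distrib_left)
    then have "H k + f * G \<in> ?I" using prime pow by blast
    then have "H k \<in> vanishing_ideal Y"
      using f(1) \<open>Y \<subseteq> Z\<close> by (fastforce simp: vanishing_ideal_over_def)
    then show ?case
      using spec[OF spec[OF indep[unfolded alg_indep_on_def], of d], of "\<lambda>e. c (k # e)"]
      unfolding H_def by (rule mp[rotated])
  qed
  show "\<forall>e\<in>exps (length (f # fs)) d. c e = 0"
    using zero by (auto simp: exps_def length_Suc_conv)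
qed

text \<open>
  Each step of the chain contributes a function that vanishes on the smaller set but not on the larger one.
\<close>

lemma chain_alg_indep:
  assumes "\<And>i. i \<le> n \<Longrightarrow> irreducible_variety (Z i)" "\<And>i. i < n \<Longrightarrow> Z i \<subset> Z (Suc i)"
  shows "\<exists>fs. length fs = n \<and> alg_indep_on (Z n) fs"
  using assms
proof (induction n)
  case 0
  have "Z 0 \<noteq> {}" using 0(1)[of 0] by (simp add: irreducible_variety_def)
  then obtain p where "p \<in> Z 0" by blast
  then have "alg_indep_on (Z 0) []"
    by (auto simp: alg_indep_on_def vanishing_ideal_over_def)
  then show ?case by auto
next
  case (Suc n)
  have "\<exists>fs. length fs = n \<and> alg_indep_on (Z n) fs"
  proof (rule Suc.IH)
    show "irreducible_variety (Z i)" if "i \<le> n" for i using Suc.prems(1)[of i] that by simp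
    show "Z i \<subset> Z (Suc i)" if "i < n" for i using Suc.prems(2)[of i] that by simp
  qed
  then obtain fs where fs: "length fs = n" "alg_indep_on (Z n) fs" by blast
  have sub: "Z n \<subset> Z (Suc n)" and irr: "irreducible_variety (Z n)" "irreducible_variety (Z (Suc n))"
    using Suc.prems by simp_all
  then obtain p where p: "p \<in> Z (Suc n)" "p \<notin> Z n" by blast
  have "zariski_closed (Z n)" using irr(1) by (simp add: irreducible_variety_def)
  then obtain f where f: "f \<in> vanishing_ideal (Z n)" "eval_mpoly p f \<noteq> 0"
    using zariski_closed_separate p(2) by metis
  have "alg_indep_on (Z (Suc n)) (f # fs)"
    using fs(2) _ irreducible_variety_prime[OF irr(2)] f(1)
  proof (rule alg_indep_on_Cons)
    show "Z n \<subseteq> Z (Suc n)" using sub by blast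
    show "f \<notin> vanishing_ideal (Z (Suc n))" using p f by (auto simp: vanishing_ideal_over_def)
  qed
  with fs(1) show ?case by (metis length_Cons)
qed

section \<open>Counting monomials\<close>

text \<open>
  Gaussian elimination: an equation with a nonzero coefficient \<open>m k t\<close> expresses the unknown with index \<open>k\<close> by the others.
\<close>

lemma underdetermined_system:
  fixes m :: "'j \<Rightarrow> 't \<Rightarrow> 'f::field"
  assumes "finite T" "finite J" "card T < card J"
  shows "\<exists>c. (\<exists>j\<in>J. c j \<noteq> 0) \<and> (\<forall>t\<in>T. (\<Sum>j\<in>J. c j * m j t) = 0)"
  using assms
proof (induction T arbitrary: J m rule: finite_induct)
  case empty
  then have "J \<noteq> {}" by auto
  then show ?case by (intro exI[of _ "\<lambda>_. 1"]) auto
next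
  case (insert t T)
  show ?case
  proof (cases "\<forall>j\<in>J. m j t = 0")
    case True
    have "card T < card J" using insert by simp
    from insert.IH[OF insert.prems(1) this] show ?thesis using True by fastforce
  next
    case False
    then obtain k where k: "k \<in> J" "m k t \<noteq> 0" by blast
    define m' where "m' j s = m j s - m j t / m k t * m k s" for j s
    have "card T < card (J - {k})"
      using insert k by (simp add: card_Diff_singleton)
    then obtain c where c: "\<exists>j\<in>J - {k}. c j \<noteq> 0"
      "\<And>s. s \<in> T \<Longrightarrow> (\<Sum>j\<in>J - {k}. c j * m' j s) = 0"
      using insert.IH[of "J - {k}" m'] insert.prems by auto
    define x where "x = - (\<Sum>j\<in>J - {k}. c j * m j t) / m k t"
    have sum: "(\<Sum>j\<in>J. (c(k := x)) j * m j s) = x * m k s + (\<Sum>j\<in>J - {k}. c j * m j s)" for s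
    proof -
      have "(\<Sum>j\<in>J. (c(k := x)) j * m j s)
          = (c(k := x)) k * m k s + (\<Sum>j\<in>J - {k}. (c(k := x)) j * m j s)"
        using insert.prems(1) k(1) by (rule sum.remove)
      also have "(\<Sum>j\<in>J - {k}. (c(k := x)) j * m j s) = (\<Sum>j\<in>J - {k}. c j * m j s)"
        by (rule sum.cong) auto
      finally show ?thesis by simp
    qed
    have "(\<Sum>j\<in>J. (c(k := x)) j * m j s) = 0" if s: "s \<in> insert t T" for s
    proof (cases "s = t")
      case True
      then show ?thesis unfolding sum using k by (simp add: x_def)
    next
      case False
      then have "0 = (\<Sum>j\<in>J - {k}. c j * m' j s)" using c(2) s by simp
      also have "\<dots> = (\<Sum>j\<in>J - {k}. c j * m j s - (c j * m j t) * (m k s / m k t))"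
        by (rule sum.cong) (simp_all add: m'_def algebra_simps)
      also have "\<dots> = (\<Sum>j\<in>J - {k}. c j * m j s) - (\<Sum>j\<in>J - {k}. c j * m j t) * (m k s / m k t)"
        by (simp only: sum_subtractf sum_distrib_right)
      also have "\<dots> = x * m k s + (\<Sum>j\<in>J - {k}. c j * m j s)"
        by (simp add: x_def)
      finally show ?thesis unfolding sum by simp
    qed
    moreover have "\<exists>j\<in>J. (c(k := x)) j \<noteq> 0" using c(1) by auto
    ultimately show ?thesis by blast
  qed
qed

text \<open>
  The exponents of polynomials whose degree in each variable is at most \<open>D\<close>.
\<close>

definition box :: "nat \<Rightarrow> ('n::finite \<Rightarrow>\<^sub>0 nat) set"
  where "box D = {m. \<forall>i. Poly_Mapping.lookup m i \<le> D}"

lemma finite_box: "finite (box D :: ('n::finite \<Rightarrow>\<^sub>0 nat) set)"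
  and card_box: "card (box D :: ('n::finite \<Rightarrow>\<^sub>0 nat) set) \<le> (D + 1) ^ CARD('n)"
proof -
  let ?P = "PiE (UNIV :: 'n set) (\<lambda>_. {..D})"
  have fin: "finite ?P" by (rule finite_PiE) simp_all
  have inj: "inj_on Poly_Mapping.lookup (box D :: ('n \<Rightarrow>\<^sub>0 nat) set)"
    by (auto simp: inj_on_def intro: poly_mapping_eqI)
  have sub: "Poly_Mapping.lookup ` (box D :: ('n \<Rightarrow>\<^sub>0 nat) set) \<subseteq> ?P"
    by (auto simp: box_def)
  show "finite (box D :: ('n \<Rightarrow>\<^sub>0 nat) set)"
    using inj_on_finite[OF inj sub fin] .
  have "card (box D :: ('n \<Rightarrow>\<^sub>0 nat) set) \<le> card ?P" by (rule card_inj_on_le[OF inj sub fin])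
  then show "card (box D :: ('n \<Rightarrow>\<^sub>0 nat) set) \<le> (D + 1) ^ CARD('n)"
    by (simp add: card_PiE)
qed

lemma keys_mult_box:
  assumes "Poly_Mapping.keys f \<subseteq> box D" "Poly_Mapping.keys g \<subseteq> box E"
  shows "Poly_Mapping.keys (f * g) \<subseteq> box (D + E)"
proof
  fix m assume "m \<in> Poly_Mapping.keys (f * g)"
  then obtain a b where "m = a + b" "a \<in> Poly_Mapping.keys f" "b \<in> Poly_Mapping.keys g"
    using keys_mult[of f g] by blast
  then show "m \<in> box (D + E)"
    using assms by (fastforce simp: box_def lookup_add intro: add_mono)
qed

lemma keys_one_box: "Poly_Mapping.keys (1 :: ('n::finite, 'f::comm_ring_1) mpoly) \<subseteq> box D"
  by (auto simp: box_def)

lemma keys_power_box: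
  fixes f :: "('n::finite, 'f::comm_ring_1) mpoly"
  shows "Poly_Mapping.keys f \<subseteq> box D \<Longrightarrow> Poly_Mapping.keys (f ^ k) \<subseteq> box (k * D)"
proof (induction k)
  case 0
  show ?case unfolding power_0 by (rule keys_one_box)
next
  case (Suc k)
  then show ?case unfolding power_Suc mult_Suc by (intro keys_mult_box)
qed

lemma keys_mvar_box: "Poly_Mapping.keys (mvar i :: ('n::finite, 'f::comm_ring_1) mpoly) \<subseteq> box 1"
  by (auto simp: mvar_def box_def lookup_single when_def)

lemma box_mono: "D \<le> E \<Longrightarrow> box D \<subseteq> box E"
  by (auto simp: box_def intro: order_trans)

lemma keys_subset_box: "\<exists>D. Poly_Mapping.keys f \<subseteq> box D"
proof -
  have "\<exists>D. K \<subseteq> box D" if "finite K" for K :: "('n::finite \<Rightarrow>\<^sub>0 nat) set"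
    using that
  proof (induction K rule: finite_induct)
    case (insert m K)
    then obtain D where D: "K \<subseteq> box D" by blast
    let ?E = "Max (range (Poly_Mapping.lookup m))"
    have "m \<in> box ?E" by (auto simp: box_def)
    then have "insert m K \<subseteq> box (max D ?E)"
      using D box_mono[of D "max D ?E"] box_mono[of ?E "max D ?E"] by auto
    then show ?case by blast
  qed simp
  then show ?thesis using finite_keys by blast
qed

text \<open>
  More functions than monomials in the bounded box: comparing coefficients gives a linear system with more unknowns
  than equations.
\<close>

lemma too_many_functions:
  fixes y :: "'p \<Rightarrow> 'f::field ^ 'm::finite" and F :: "'p \<Rightarrow> 'j \<Rightarrow> 'f" and B :: nat
  assumes "finite J" "(B + 1) ^ CARD('m) < card J"
    and rep: "\<And>j. j \<in> J \<Longrightarrow> \<exists>Q. Poly_Mapping.keys Q \<subseteq> box B \<and> (\<forall>p\<in>A. F p j = eval_mpoly (y p) Q)"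
  shows "\<exists>c. (\<exists>j\<in>J. c j \<noteq> 0) \<and> (\<forall>p\<in>A. (\<Sum>j\<in>J. c j * F p j) = 0)"
proof -
  obtain Q where Q: "\<And>j. j \<in> J \<Longrightarrow> Poly_Mapping.keys (Q j) \<subseteq> box B"
    "\<And>j p. j \<in> J \<Longrightarrow> p \<in> A \<Longrightarrow> F p j = eval_mpoly (y p) (Q j)"
    using rep by metis
  let ?T = "box B :: ('m \<Rightarrow>\<^sub>0 nat) set"
  have "card ?T < card J" using card_box assms(2) by (rule le_less_trans)
  then obtain c where c: "\<exists>j\<in>J. c j \<noteq> 0"
    "\<And>m. m \<in> ?T \<Longrightarrow> (\<Sum>j\<in>J. c j * Poly_Mapping.lookup (Q j) m) = 0"
    using underdetermined_system[OF finite_box assms(1), of B "\<lambda>j. Poly_Mapping.lookup (Q j)"] by blast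
  have "(\<Sum>j\<in>J. c j * F p j) = 0" if "p \<in> A" for p
  proof -
    let ?M = "\<lambda>m. \<Prod>i\<in>UNIV. (y p $ i) ^ Poly_Mapping.lookup m i"
    have "(\<Sum>j\<in>J. c j * F p j) = (\<Sum>j\<in>J. \<Sum>m\<in>?T. c j * Poly_Mapping.lookup (Q j) m * ?M m)"
    proof (rule sum.cong)
      fix j assume "j \<in> J"
      then show "c j * F p j = (\<Sum>m\<in>?T. c j * Poly_Mapping.lookup (Q j) m * ?M m)"
        using Q that by (simp add: coefficient_map.eval_superset[OF coefficient_map_id finite_box, of _ B] sum_distrib_left mult.assoc)
    qed simp
    also have "\<dots> = (\<Sum>m\<in>?T. (\<Sum>j\<in>J. c j * Poly_Mapping.lookup (Q j) m) * ?M m)"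
      by (subst sum.swap) (simp add: sum_distrib_right)
    also have "\<dots> = 0" by (simp add: c(2))
    finally show ?thesis .
  qed
  with c(1) show ?thesis by blast
qed

section \<open>Dimension of the Jacobi locus\<close>

text \<open>
  With \<open>u\<close> the first unit vector the correction changes only the first row and column of \<open>M\<close>; the listed coordinates
  are the entries with row and column index 2 or 3, up to sign.
\<close>

lemma correction_axis_1:
  "correction (axis 1 1) r t $ 3 = 0" "correction (axis 1 1) r t $ 5 = 0" "correction (axis 1 1) r t $ 6 = 0"
  by (simp_all add: correction_def axis_def)

text \<open>
  Start from any point with the prescribed values and correct its Jacobi vector without touching them.
\<close>

lemma jac_point_exists:
  fixes c :: "'f::field"
  assumes "c \<noteq> 0"
  shows "\<exists>p. jac p = v \<and> tvec p = vector [c, t2, t3] \<and> p $ 5 = s5 \<and> p $ 6 = s6 \<and> p $ 3 = s3"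
proof -
  define p0 :: "'f ^ 9" where "p0 = (\<chi> k. if k = 2 then c - s6 else if k = 6 then s6 else
    if k = 5 then s5 else if k = 3 then s3 else if k = 9 then t2 else if k = 4 then - t3 else 0)"
  have t: "tvec p0 = vector [c, t2, t3]"
    by (simp add: tvec_def p0_def vec_eq_iff forall_3)
  let ?C = "correction (axis 1 1) (v - jac p0) (tvec p0)"
  let ?p = "p0 + inverse (c ^ 2) *s ?C"
  have "jac ?p = jac p0 + (v - jac p0)"
    by (rule jac_add_correction) (use assms in \<open>simp add: dot_axis t\<close>)
  moreover have "tvec ?p = tvec p0" by (simp add: tvec_add tvec_scale tvec_correction)
  moreover have "?p $ 5 = s5" "?p $ 6 = s6" "?p $ 3 = s3"
    by (simp_all add: correction_axis_1 p0_def)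
  ultimately show ?thesis using t by (intro exI[of _ ?p]) simp
qed

lemma zariski_closed_jac_locus: "zariski_closed (jac_locus I w)"
  unfolding zariski_closed_def
  by (rule exI[of _ "jac_poly w ` I"])
     (auto simp: jac_locus_def coefficient_map.eval_jac_poly[OF coefficient_map_id])

lemma jac_locus_nonempty: "jac_locus I w \<noteq> {}"
proof -
  obtain p where "jac p = w" using jac_point_exists[of 1 w 0 0 0 0 0] by auto
  then show ?thesis by (auto simp: jac_locus_def)
qed

lemma irreducible_jac_locus:
  fixes w :: "'f::field ^ 3"
  assumes "infinite (UNIV :: 'f set)" "i \<in> I" "w $ i \<noteq> 0"
  shows "irreducible_variety (jac_locus I w)"
  using assms
  by (intro irreducible_varietyI zariski_closed_jac_locus jac_locus_nonempty rationally_connected_jac_locus)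

subsection \<open>At most six independent functions\<close>

text \<open>
  Where \<open>t\<^sub>1 \<noteq> 0\<close>, these six functions determine a point with given Jacobi vector.
\<close>

definition coords :: "'f::field ^ 9 \<Rightarrow> 'f ^ 6"
  where "coords p = (\<chi> k. if k = 1 then tvec p $ 1 else if k = 2 then tvec p $ 2 else
    if k = 3 then tvec p $ 3 else if k = 4 then p $ 5 else if k = 5 then p $ 6 else p $ 3)"

lemma coords_nth [simp]:
  "coords p $ 1 = tvec p $ 1" "coords p $ 2 = tvec p $ 2" "coords p $ 3 = tvec p $ 3"
  "coords p $ 4 = p $ 5" "coords p $ 5 = p $ 6" "coords p $ 6 = p $ 3"
  by (simp_all add: coords_def)

text \<open>
  On \<open>A\<close>, and up to the \<open>N\<close>-th power of \<open>t\<^sub>1\<close>, the function \<open>g\<close> is a polynomial in the six coordinates, with degree at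
  most \<open>D\<close> in each of them.
\<close>

definition represented :: "('f::field ^ 9) set \<Rightarrow> nat \<Rightarrow> nat \<Rightarrow> ('f ^ 9 \<Rightarrow> 'f) \<Rightarrow> bool"
  where "represented A N D g \<longleftrightarrow> (\<exists>Q. Poly_Mapping.keys Q \<subseteq> box D \<and>
    (\<forall>p\<in>A. (tvec p $ 1) ^ N * g p = eval_mpoly (coords p) Q))"

definition representable :: "('f::field ^ 9) set \<Rightarrow> ('f ^ 9 \<Rightarrow> 'f) \<Rightarrow> bool"
  where "representable A g \<longleftrightarrow> (\<exists>N D. represented A N D g)"

lemma representableI:
  "(\<And>p. p \<in> A \<Longrightarrow> (tvec p $ 1) ^ N * g p = eval_mpoly (coords p) Q) \<Longrightarrow> representable A g"
  unfolding representable_def represented_def using keys_subset_box[of Q] by metis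

lemma representableE:
  assumes "representable A g"
  obtains N Q where "\<And>p. p \<in> A \<Longrightarrow> (tvec p $ 1) ^ N * g p = eval_mpoly (coords p) Q"
  using assms unfolding representable_def represented_def by blast

lemma representable_const: "representable A (\<lambda>_. c)"
  by (rule representableI[where N = 0 and Q = "mconst c"]) simp

lemma representable_coords: "representable A (\<lambda>p. coords p $ k)"
  by (rule representableI[where N = 0 and Q = "mvar k"]) simp

lemma representable_cong:
  "representable A g \<Longrightarrow> (\<And>p. p \<in> A \<Longrightarrow> g p = g' p) \<Longrightarrow> representable A g'"
  unfolding representable_def represented_def by simp

lemma representable_add:
  assumes "representable A f" "representable A g"
  shows "representable A (\<lambda>p. f p + g p)"
proof -
  obtain N P where P: "\<And>p. p \<in> A \<Longrightarrow> (tvec p $ 1) ^ N * f p = eval_mpoly (coords p) P"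
    using representableE[OF assms(1)] by blast
  obtain M Q where Q: "\<And>p. p \<in> A \<Longrightarrow> (tvec p $ 1) ^ M * g p = eval_mpoly (coords p) Q"
    using representableE[OF assms(2)] by blast
  show ?thesis
    by (rule representableI[where N = "N + M" and Q = "mvar 1 ^ M * P + mvar 1 ^ N * Q"])
       (simp add: power_add distrib_left distrib_right mult_ac flip: P Q)
qed

lemma representable_mult:
  assumes "representable A f" "representable A g"
  shows "representable A (\<lambda>p. f p * g p)"
proof -
  obtain N P where P: "\<And>p. p \<in> A \<Longrightarrow> (tvec p $ 1) ^ N * f p = eval_mpoly (coords p) P"
    using representableE[OF assms(1)] by blast
  obtain M Q where Q: "\<And>p. p \<in> A \<Longrightarrow> (tvec p $ 1) ^ M * g p = eval_mpoly (coords p) Q"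
    using representableE[OF assms(2)] by blast
  show ?thesis
    by (rule representableI[where N = "N + M" and Q = "P * Q"])
       (simp add: power_add mult_ac flip: P Q)
qed

lemma representable_diff:
  assumes "representable A f" "representable A g"
  shows "representable A (\<lambda>p. f p - g p)"
  using representable_add[OF assms(1) representable_mult[OF representable_const[of A "-1"] assms(2)]]
  by simp

lemma representable_quotient:
  assumes "representable A (\<lambda>p. tvec p $ 1 * f p)"
  shows "representable A f"
proof -
  obtain N P where P: "\<And>p. p \<in> A \<Longrightarrow> (tvec p $ 1) ^ N * (tvec p $ 1 * f p) = eval_mpoly (coords p) P"
    using representableE[OF assms] by blast
  show ?thesis
    by (rule representableI[where N = "Suc N" and Q = P]) (simp add: mult_ac flip: P)
qed

text \<open>
  The equations \<open>M t = w\<close> and the definition of \<open>t\<close> can be solved for the remaining coordinates, one after the other,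
  dividing by \<open>t\<^sub>1\<close> only.
\<close>

lemma representable_coordinate: "representable (jac_locus UNIV w) (\<lambda>p. p $ k)"
proof -
  let ?A = "jac_locus UNIV w"
  note rep = representable_add representable_diff representable_mult representable_const
  have t: "representable ?A (\<lambda>p. tvec p $ 1)" "representable ?A (\<lambda>p. tvec p $ 2)"
      "representable ?A (\<lambda>p. tvec p $ 3)"
    and s: "representable ?A (\<lambda>p. p $ 5)" "representable ?A (\<lambda>p. p $ 6)" "representable ?A (\<lambda>p. p $ 3)"
    using representable_coords[of ?A 1] representable_coords[of ?A 2] representable_coords[of ?A 3]
      representable_coords[of ?A 4] representable_coords[of ?A 5] representable_coords[of ?A 6]
    by simp_all
  have eq: "tvec p $ 1 * p $ 7 = w $ 1 + tvec p $ 2 * p $ 4 - tvec p $ 3 * p $ 1"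
    "tvec p $ 1 * p $ 8 = w $ 2 + tvec p $ 2 * p $ 5 - tvec p $ 3 * p $ 2"
    "tvec p $ 1 * p $ 9 = w $ 3 + tvec p $ 2 * p $ 6 - tvec p $ 3 * p $ 3" if "p \<in> ?A" for p
    using that by (auto simp: jac_locus_def jac_def forall_3 algebra_simps)
  have p2: "representable ?A (\<lambda>p. p $ 2)"
    by (rule representable_cong[of _ "\<lambda>p. tvec p $ 1 - p $ 6"]) (intro rep t s, simp add: tvec_def)
  have p8: "representable ?A (\<lambda>p. p $ 8)"
    by (rule representable_quotient, rule representable_cong[of _ "\<lambda>p. w $ 2 + tvec p $ 2 * p $ 5 - tvec p $ 3 * p $ 2"])
       (intro rep t s p2, simp add: eq)
  have p9: "representable ?A (\<lambda>p. p $ 9)"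
    by (rule representable_quotient, rule representable_cong[of _ "\<lambda>p. w $ 3 + tvec p $ 2 * p $ 6 - tvec p $ 3 * p $ 3"])
       (intro rep t s, simp add: eq)
  have p4: "representable ?A (\<lambda>p. p $ 4)"
    by (rule representable_cong[of _ "\<lambda>p. 0 - tvec p $ 3 - p $ 8"]) (intro rep t p8, simp add: tvec_def)
  have p1: "representable ?A (\<lambda>p. p $ 1)"
    by (rule representable_cong[of _ "\<lambda>p. p $ 9 - tvec p $ 2"]) (intro rep t p9, simp add: tvec_def)
  have p7: "representable ?A (\<lambda>p. p $ 7)"
    by (rule representable_quotient, rule representable_cong[of _ "\<lambda>p. w $ 1 + tvec p $ 2 * p $ 4 - tvec p $ 3 * p $ 1"])
       (intro rep t p4 p1, simp add: eq)
  show ?thesis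
    using exhaust_9[of k] s p1 p2 p4 p7 p8 p9 by (elim disjE) simp_all
qed

lemma representable_polynomial: "representable (jac_locus UNIV w) (\<lambda>p. eval_mpoly p f)"
proof (induction f rule: mpoly_induct)
  case (const c)
  show ?case using representable_const by simp
next
  case (var i)
  show ?case using representable_coordinate by simp
next
  case (add f g)
  then show ?case using representable_add by simp
next
  case (mult f g)
  then show ?case using representable_mult by simp
qed

lemma represented_mono:
  assumes "represented A N D g" "N \<le> M" "D + M \<le> E"
  shows "represented A M E g"
proof -
  obtain Q where Q: "Poly_Mapping.keys Q \<subseteq> box D"
    "\<And>p. p \<in> A \<Longrightarrow> (tvec p $ 1) ^ N * g p = eval_mpoly (coords p) Q"
    using assms(1) unfolding represented_def by blast
  have "Poly_Mapping.keys (mvar 1 ^ (M - N) * Q) \<subseteq> box ((M - N) * 1 + D)"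
    by (intro keys_mult_box keys_power_box keys_mvar_box Q)
  also have "\<dots> \<subseteq> box E" using assms(3) by (intro box_mono) simp
  finally have "Poly_Mapping.keys (mvar 1 ^ (M - N) * Q) \<subseteq> box E" .
  moreover have "(tvec p $ 1) ^ M * g p = eval_mpoly (coords p) (mvar 1 ^ (M - N) * Q)" if "p \<in> A" for p
  proof -
    have "(tvec p $ 1) ^ M = (tvec p $ 1) ^ (M - N) * (tvec p $ 1) ^ N"
      using assms(2) by (simp flip: power_add)
    then show ?thesis using Q(2)[OF that] by (simp add: mult.assoc)
  qed
  ultimately show ?thesis unfolding represented_def by blast
qed

lemma represented_mult:
  assumes "represented A N D f" "represented A M E g"
  shows "represented A (N + M) (D + E) (\<lambda>p. f p * g p)"
proof -
  obtain P where P: "Poly_Mapping.keys P \<subseteq> box D"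
    "\<And>p. p \<in> A \<Longrightarrow> (tvec p $ 1) ^ N * f p = eval_mpoly (coords p) P"
    using assms(1) unfolding represented_def by blast
  obtain Q where Q: "Poly_Mapping.keys Q \<subseteq> box E"
    "\<And>p. p \<in> A \<Longrightarrow> (tvec p $ 1) ^ M * g p = eval_mpoly (coords p) Q"
    using assms(2) unfolding represented_def by blast
  show ?thesis
    unfolding represented_def
    by (rule exI[of _ "P * Q"])
       (use keys_mult_box[OF P(1) Q(1)] in \<open>auto simp: power_add mult_ac simp flip: P(2) Q(2)\<close>)
qed

lemma represented_one: "represented A 0 D (\<lambda>_. 1)"
  unfolding represented_def using keys_one_box by (intro exI[of _ 1]) auto

lemma represented_power:
  "represented A N D f \<Longrightarrow> represented A (k * N) (k * D) (\<lambda>p. f p ^ k)"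
proof (induction k)
  case 0
  show ?case using represented_one[of A 0] by simp
next
  case (Suc k)
  then show ?case using represented_mult[of A N D f "k * N" "k * D"] by simp
qed

lemma uniformly_represented:
  "\<exists>N D. \<forall>f\<in>set fs. represented (jac_locus UNIV w) N D (\<lambda>p. eval_mpoly p f)"
proof (induction fs)
  case (Cons f fs)
  then obtain N D where ND: "\<And>g. g \<in> set fs \<Longrightarrow> represented (jac_locus UNIV w) N D (\<lambda>p. eval_mpoly p g)"
    by blast
  obtain M E where ME: "represented (jac_locus UNIV w) M E (\<lambda>p. eval_mpoly p f)"
    using representable_polynomial[of w f] unfolding representable_def by blast
  have "represented (jac_locus UNIV w) (N + M) (D + E + N + M) (\<lambda>p. eval_mpoly p g)"
    if "g \<in> set (f # fs)" for g
    using that by (auto intro: represented_mono[OF ND] represented_mono[OF ME])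
  then show ?case by blast
qed simp

lemma represented_power_product:
  assumes "\<And>f. f \<in> set fs \<Longrightarrow> represented A N D (\<lambda>p. eval_mpoly p f)" "e \<in> exps (length fs) d"
  shows "represented A (length fs * (d * N)) (length fs * (d * D + d * N)) (\<lambda>p. eval_mpoly p (power_product fs e))"
  using assms
proof (induction fs arbitrary: e)
  case Nil
  then show ?case using represented_one[of A 0] by simp
next
  case (Cons f fs)
  then obtain j e' where e: "e = j # e'" "j \<le> d" "e' \<in> exps (length fs) d"
    by (auto simp: exps_def length_Suc_conv)
  have "represented A (j * N) (j * D) (\<lambda>p. eval_mpoly p f ^ j)"
    using Cons.prems(1) by (intro represented_power) simp
  then have "represented A (d * N) (d * D + d * N) (\<lambda>p. eval_mpoly p f ^ j)"
    by (rule represented_mono) (use e in \<open>simp_all add: add_mono\<close>)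
  from represented_mult[OF this Cons.IH[OF _ e(3)]] Cons.prems(1)
  show ?case by (simp add: e)
qed

text \<open>
  The \<open>(d + 1)\<^sup>7\<close> power products of seven functions with exponents at most \<open>d\<close> are, up to a common power of \<open>t\<^sub>1\<close>,
  polynomials in six coordinates of degree at most \<open>K (d + 1) - 1\<close> in each, with \<open>K\<close> independent of \<open>d\<close>. There are
  \<open>(K (d + 1))\<^sup>6\<close> monomials, which are fewer as soon as \<open>d \<ge> K\<^sup>6\<close>. The resulting relation holds after multiplication by
  a power of \<open>t\<^sub>1\<close>, which can be cancelled because the vanishing ideal is prime.
\<close>

theorem no_seven_alg_indep:
  fixes w :: "'f::field ^ 3"
  assumes inf: "infinite (UNIV :: 'f set)" and w: "w $ i \<noteq> 0" and len: "length fs = 7"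
  shows "\<not> alg_indep_on (jac_locus UNIV w) fs"
proof
  let ?A = "jac_locus UNIV w"
  assume indep: "alg_indep_on ?A fs"
  obtain N D where ND: "\<And>f. f \<in> set fs \<Longrightarrow> represented ?A N D (\<lambda>p. eval_mpoly p f)"
    using uniformly_represented[of fs w] by blast
  define K where "K = 7 * (D + N) + 1"
  define d where "d = K ^ 6"
  define M where "M = 7 * (d * N)"
  define B where "B = 7 * (d * D + d * N)"
  have rep: "represented ?A M B (\<lambda>p. eval_mpoly p (power_product fs e))" if "e \<in> exps 7 d" for e
    using represented_power_product[OF ND, of fs e d] that unfolding M_def B_def len by simp
  have "B + 1 \<le> K * (d + 1)" by (simp add: B_def K_def algebra_simps)
  then have "(B + 1) ^ 6 \<le> (K * (d + 1)) ^ 6" by (rule power_mono) simp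
  also have "\<dots> = d * (d + 1) ^ 6" by (simp only: power_mult_distrib d_def)
  also have "\<dots> < (d + 1) * (d + 1) ^ 6" by simp
  also have "\<dots> = card (exps 7 d)" by (simp only: card_exps power_Suc[symmetric]) simp
  finally have card: "(B + 1) ^ CARD(6) < card (exps 7 d)" by simp
  have "\<exists>c. (\<exists>e\<in>exps 7 d. c e \<noteq> 0) \<and>
      (\<forall>p\<in>?A. (\<Sum>e\<in>exps 7 d. c e * ((tvec p $ 1) ^ M * eval_mpoly p (power_product fs e))) = 0)"
    by (rule too_many_functions[OF finite_exps card, where y = coords])
       (use rep in \<open>auto simp: represented_def\<close>)
  then obtain c where c: "\<exists>e\<in>exps 7 d. c e \<noteq> 0"
    "\<And>p. p \<in> ?A \<Longrightarrow> (\<Sum>e\<in>exps 7 d. c e * ((tvec p $ 1) ^ M * eval_mpoly p (power_product fs e))) = 0"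
    by blast
  let ?t = "tvec generic $ 1 :: (9, 'f) mpoly"
  let ?S = "\<Sum>e\<in>exps 7 d. mconst (c e) * power_product fs e"
  note prime = infinite_extension.vanishing_ideal_prime[OF infinite_extension_id[OF inf]
      rationally_connected_jac_locus[of i UNIV w, OF UNIV_I w]]
  have eval_t: "eval_mpoly p ?t = tvec p $ 1" for p
    by (rule coefficient_map.eval_tvec[OF coefficient_map_id])
  have "eval_mpoly p (?t ^ M * ?S) = 0" if "p \<in> ?A" for p
    using c(2)[OF that]
    by (simp add: coefficient_map.eval_sum[OF coefficient_map_id] eval_t sum_distrib_left mult.left_commute)
  then have "?t ^ M * ?S \<in> vanishing_ideal ?A" by (simp add: vanishing_ideal_over_def)
  then have "?t ^ M \<in> vanishing_ideal ?A \<or> ?S \<in> vanishing_ideal ?A" by (rule prime)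
  moreover have "?t ^ M \<notin> vanishing_ideal ?A"
  proof -
    obtain p where "jac p = w" "tvec p = vector [1, 0, 0]"
      using jac_point_exists[of 1 w 0 0 0 0 0] by auto
    then show ?thesis
      by (auto simp: vanishing_ideal_over_def jac_locus_def eval_t intro!: exI[of _ p])
  qed
  ultimately have "?S \<in> vanishing_ideal ?A" by blast
  then have "\<forall>e\<in>exps 7 d. c e = 0"
    using indep unfolding alg_indep_on_def len by blast
  with c(1) show False by blast
qed

subsection \<open>A flag of irreducible subvarieties\<close>

text \<open>
  The first equation cuts out the slice \<open>t\<^sub>1 = 1\<close>, on which the other five are free coordinates.
\<close>

definition flag_poly :: "nat \<Rightarrow> (9, 'f::field) mpoly"
  where "flag_poly j = [tvec generic $ 1 - 1, tvec generic $ 2, tvec generic $ 3, mvar 5, mvar 6, mvar 3] ! j"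

definition flag :: "'f::field ^ 3 \<Rightarrow> nat \<Rightarrow> ('f ^ 9) set"
  where "flag w i = {p \<in> jac_locus UNIV w. \<forall>f\<in>flag_poly ` {..<6 - i}. eval_mpoly p f = 0}"

lemma eval_flag_poly:
  "eval_mpoly p (flag_poly 0) = tvec p $ 1 - 1" "eval_mpoly p (flag_poly 1) = tvec p $ 2"
  "eval_mpoly p (flag_poly 2) = tvec p $ 3" "eval_mpoly p (flag_poly 3) = p $ 5"
  "eval_mpoly p (flag_poly 4) = p $ 6" "eval_mpoly p (flag_poly 5) = p $ 3"
  by (simp_all add: flag_poly_def coefficient_map.eval_tvec[OF coefficient_map_id])

lemma less_6_cases: "j < 6 \<longleftrightarrow> j = 0 \<or> j = 1 \<or> j = 2 \<or> j = 3 \<or> j = 4 \<or> j = (5::nat)"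
  by linarith

text \<open>
  The equations of the flag are affine-linear and insensitive to the correction, so the curves that join points of the
  locus inside the slice \<open>t\<^sub>1 = 1\<close> stay in each member of the flag.
\<close>

lemma flag_poly_on_curve:
  assumes "j < 6"
  shows "eval_mpoly ((1 - s) *s p + s *s q + c *s correction (axis 1 1) r t) (flag_poly j)
    = (1 - s) * eval_mpoly p (flag_poly j) + s * eval_mpoly q (flag_poly j)"
proof -
  have t: "tvec ((1 - s) *s p + s *s q + c *s correction (axis 1 1) r t) = (1 - s) *s tvec p + s *s tvec q"
    by (simp add: tvec_add tvec_scale tvec_correction)
  show ?thesis
    using assms unfolding less_6_cases
    by (elim disjE) (simp_all add: eval_flag_poly[unfolded One_nat_def] eval_flag_poly t correction_axis_1 left_diff_distrib right_diff_distrib)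
qed

lemma flag_poly_point:
  fixes w :: "'f::field ^ 3"
  assumes inf: "infinite (UNIV :: 'f set)" and "k < 6"
  obtains p where "p \<in> jac_locus UNIV w" "\<And>j. j < k \<Longrightarrow> eval_mpoly p (flag_poly j) = 0"
    "eval_mpoly p (flag_poly k) \<noteq> 0"
proof -
  obtain c :: 'f where c: "c \<notin> {0, 1}"
    using inf ex_new_if_finite[of "{0, 1::'f}"] by blast
  then have c': "(if k = 0 then c else 1) \<noteq> 0" by auto
  obtain p where p: "jac p = w" "tvec p = vector [if k = 0 then c else 1, of_bool (k = 1), of_bool (k = 2)]"
    "p $ 5 = of_bool (k = 3)" "p $ 6 = of_bool (k = 4)" "p $ 3 = of_bool (k = 5)"
    using jac_point_exists[OF c', of w "of_bool (k = 1)" "of_bool (k = 2)"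
        "of_bool (k = 3)" "of_bool (k = 4)" "of_bool (k = 5)"] by blast
  have val: "(eval_mpoly p (flag_poly j) = 0) = (j \<noteq> k)" if "j < 6" for j
    using that unfolding less_6_cases
    by (elim disjE) (use c in \<open>auto simp: eval_flag_poly[unfolded One_nat_def] eval_flag_poly p\<close>)
  show ?thesis
    by (rule that[of p]) (use assms val p(1) in \<open>auto simp: jac_locus_def\<close>)
qed

lemma irreducible_flag:
  fixes w :: "'f::field ^ 3"
  assumes inf: "infinite (UNIV :: 'f set)" and w: "w $ k \<noteq> 0" and "i \<le> 6"
  shows "irreducible_variety (flag w i)"
proof (cases "i = 6")
  case True
  then show ?thesis using irreducible_jac_locus[OF inf _ w, of UNIV] by (simp add: flag_def)
next
  case False
  then have 0: "0 < 6 - i" using assms(3) by simp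
  show ?thesis
  proof (rule irreducible_varietyI[OF inf])
    show "zariski_closed (flag w i)"
      unfolding flag_def by (rule zariski_closed_Int_zeros[OF zariski_closed_jac_locus])
    obtain p where "jac p = w" "tvec p = vector [1, 0, 0]" "p $ 5 = 0" "p $ 6 = 0" "p $ 3 = 0"
      using jac_point_exists[of 1 w 0 0 0 0 0] by auto
    moreover from this have "eval_mpoly p (flag_poly j) = 0" if "j < 6" for j
      using that unfolding less_6_cases by (elim disjE) (auto simp: eval_flag_poly[unfolded One_nat_def] eval_flag_poly)
    ultimately have "p \<in> flag w i" by (auto simp: flag_def jac_locus_def)
    then show "flag w i \<noteq> {}" by blast
    show "rationally_connected (flag w i)"
      unfolding rationally_connected_def
    proof (intro ballI)
      fix p q assume p: "p \<in> flag w i" and q: "q \<in> flag w i"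
      have "eval_mpoly p (flag_poly 0) = 0" "eval_mpoly q (flag_poly 0) = 0"
        using p q 0 by (auto simp: flag_def)
      then have "dot (axis 1 1) (tvec p) \<noteq> 0" "dot (axis 1 1) (tvec q) \<noteq> 0"
        by (simp_all add: eval_flag_poly dot_axis)
      then obtain num den where *: "poly den 0 \<noteq> 0" "poly den 1 \<noteq> 0"
        "curve_point num den 0 = p" "curve_point num den 1 = q"
        and jac: "\<And>s. poly den s \<noteq> 0 \<Longrightarrow> jac (curve_point num den s) = (1 - s) *s jac p + s *s jac q"
        and pt: "\<And>s. poly den s \<noteq> 0 \<Longrightarrow>
          \<exists>c r t. curve_point num den s = (1 - s) *s p + s *s q + c *s correction (axis 1 1) r t"
        by (rule curve_exists) blast
      have "curve_point num den s \<in> flag w i" if s: "poly den s \<noteq> 0" for s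
      proof -
        have "jac p = w" "jac q = w"
          using p q by (auto simp: flag_def jac_locus_def vec_eq_iff)
        then have "jac (curve_point num den s) = w"
          using jac[OF s] by (simp add: vec_eq_iff algebra_simps)
        moreover have "eval_mpoly (curve_point num den s) (flag_poly j) = 0" if j: "j < 6 - i" for j
        proof -
          have "eval_mpoly p (flag_poly j) = 0" "eval_mpoly q (flag_poly j) = 0"
            using p q j by (auto simp: flag_def)
          moreover obtain c r t where "curve_point num den s = (1 - s) *s p + s *s q + c *s correction (axis 1 1) r t"
            using pt[OF s] by blast
          ultimately show ?thesis using flag_poly_on_curve[of j s p q c r t] j by simp
        qed
        ultimately show ?thesis by (auto simp: flag_def jac_locus_def)
      qed
      with * show "\<exists>num den. poly den 0 \<noteq> 0 \<and> poly den 1 \<noteq> 0 \<and> curve_point num den 0 = p \<and>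
          curve_point num den 1 = q \<and> (\<forall>s. poly den s \<noteq> 0 \<longrightarrow> curve_point num den s \<in> flag w i)"
        by blast
    qed
  qed
qed

lemma flag_strict:
  fixes w :: "'f::field ^ 3"
  assumes inf: "infinite (UNIV :: 'f set)" and "i < 6"
  shows "flag w i \<subset> flag w (Suc i)"
proof -
  have "5 - i < 6" by simp
  then obtain p where p: "p \<in> jac_locus UNIV w" "\<And>j. j < 5 - i \<Longrightarrow> eval_mpoly p (flag_poly j) = 0"
    "eval_mpoly p (flag_poly (5 - i)) \<noteq> 0"
    using flag_poly_point[OF inf] by metis
  have "p \<in> flag w (Suc i)" using p by (auto simp: flag_def)
  moreover have "p \<notin> flag w i"
  proof
    assume "p \<in> flag w i"
    moreover have "5 - i < 6 - i" using assms by simp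
    ultimately show False using p(3) by (auto simp: flag_def)
  qed
  moreover have "flag w i \<subseteq> flag w (Suc i)"
    by (auto simp: flag_def)
  ultimately show ?thesis by blast
qed

theorem variety_dim_jac_locus:
  fixes w :: "'f::field ^ 3"
  assumes inf: "infinite (UNIV :: 'f set)" and w: "w $ k \<noteq> 0"
  shows "variety_dim (jac_locus UNIV w) = 6"
proof (rule antisym)
  let ?A = "jac_locus UNIV w"
  show "variety_dim ?A \<le> 6"
    unfolding variety_dim_def
  proof (rule SUP_least, clarify)
    fix n and Z :: "nat \<Rightarrow> ('f ^ 9) set"
    assume Z: "\<forall>i\<le>n. irreducible_variety (Z i) \<and> Z i \<subseteq> ?A" "\<forall>i<n. Z i \<subset> Z (Suc i)"
    have "n \<le> 6"
    proof (rule ccontr)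
      assume "\<not> n \<le> 6"
      then have 7: "7 \<le> n" by simp
      have "\<exists>fs. length fs = 7 \<and> alg_indep_on (Z 7) fs"
      proof (rule chain_alg_indep)
        show "irreducible_variety (Z i)" if "i \<le> 7" for i using Z(1) that 7 by simp
        show "Z i \<subset> Z (Suc i)" if "i < 7" for i using Z(2) that 7 by simp
      qed
      then obtain fs where fs: "length fs = 7" "alg_indep_on (Z 7) fs" by blast
      have "Z 7 \<subseteq> ?A" using Z(1) 7 by blast
      with fs have "alg_indep_on ?A fs" by (blast intro: alg_indep_on_mono)
      then show False using no_seven_alg_indep[OF inf w fs(1)] by blast
    qed
    then show "enat n \<le> 6" by (simp add: numeral_eq_enat)
  qed
  have "enat 6 \<le> variety_dim ?A"
    unfolding variety_dim_def
  proof (rule SUP_upper, rule CollectI, intro exI[of _ "flag w"] conjI allI impI)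
    show "irreducible_variety (flag w i)" if "i \<le> 6" for i
      using irreducible_flag[OF inf w that] .
    show "flag w i \<subseteq> ?A" for i by (auto simp: flag_def)
    show "flag w i \<subset> flag w (Suc i)" if "i < 6" for i
      using flag_strict[OF inf that] .
  qed
  then show "6 \<le> variety_dim ?A" by (simp add: numeral_eq_enat)
qed

section \<open>Structure constants of omega-Lie algebras\<close>

definition bracket3 :: "'k::comm_ring_1 ^ 9 \<Rightarrow> 'k ^ 3 \<Rightarrow> 'k ^ 3 \<Rightarrow> 'k ^ 3"
  where "bracket3 p u v =
    (u $ 1 * v $ 2 - u $ 2 * v $ 1) *s vector [p $ 1, p $ 2, p $ 3] +
    (u $ 1 * v $ 3 - u $ 3 * v $ 1) *s vector [p $ 4, p $ 5, p $ 6] +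
    (u $ 2 * v $ 3 - u $ 3 * v $ 2) *s vector [p $ 7, p $ 8, p $ 9]"

definition form3 :: "'k::comm_ring_1 ^ 3 \<Rightarrow> 'k ^ 3 \<Rightarrow> 'k ^ 3 \<Rightarrow> 'k"
  where "form3 w u v = (u $ 2 * v $ 3 - u $ 3 * v $ 2) * w $ 1 +
    (u $ 3 * v $ 1 - u $ 1 * v $ 3) * w $ 2 + (u $ 1 * v $ 2 - u $ 2 * v $ 1) * w $ 3"

text \<open>
  As functions of \<open>u, v, s\<close> both sides are alternating and trilinear, so they are determined by their values at the unit
  vectors, where the entries of \<open>M t\<close> appear.
\<close>

lemma bracket3_jacobi:
  "bracket3 p (bracket3 p u v) s + bracket3 p (bracket3 p v s) u + bracket3 p (bracket3 p s u) v
    = form3 (jac p) u v *s s + form3 (jac p) v s *s u + form3 (jac p) s u *s v"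
  by (simp add: bracket3_def form3_def jac_def tvec_def vec_eq_iff forall_3 algebra_simps)

lemma bilinear_map_iff:
  "bilinear_map s t f \<longleftrightarrow> vector_space s \<and> vector_space t \<and>
    (\<forall>u v w. f (u + v) w = f u w + f v w) \<and> (\<forall>u v w. f u (v + w) = f u v + f u w) \<and>
    (\<forall>c u v. f (s c u) v = t c (f u v)) \<and> (\<forall>c u v. f u (s c v) = t c (f u v))"
  unfolding bilinear_map_def Vector_Spaces.linear_iff by auto

lemma vector_space_field: "vector_space ((*) :: 'k::field \<Rightarrow> 'k \<Rightarrow> 'k)"
  by unfold_locales (simp_all add: algebra_simps)

locale three_dimensional = finite_dimensional_vector_space sc "{x, y, z}"
  for sc :: "'k::field \<Rightarrow> 'v::ab_group_add \<Rightarrow> 'v" and x y z :: 'v +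
  assumes card_basis: "card {x, y, z} = 3"
begin

lemma distinct: "x \<noteq> y" "x \<noteq> z" "y \<noteq> z"
  using card_basis by (auto simp: card_insert_if split: if_splits)

definition point :: "'k ^ 3 \<Rightarrow> 'v"
  where "point c = sc (c $ 1) x + sc (c $ 2) y + sc (c $ 3) z"

definition coord :: "'v \<Rightarrow> 'k ^ 3"
  where "coord u = vector [representation {x, y, z} u x, representation {x, y, z} u y,
    representation {x, y, z} u z]"

lemma coord_add: "coord (u + v) = coord u + coord v"
  by (simp add: coord_def vec_eq_iff forall_3 representation_add independent_Basis span_Basis)

lemma coord_scale: "coord (sc c u) = c *s coord u"
  by (simp add: coord_def vec_eq_iff forall_3 representation_scale independent_Basis span_Basis)

lemma coord_minus: "coord (- u) = - coord u"
  using coord_scale[of "-1" u] by (simp add: vec_eq_iff)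

lemma coord_diff: "coord (u - v) = coord u - coord v"
  using coord_add[of u "- v"] coord_minus[of v] by simp

lemma coord_basis: "coord x = vector [1, 0, 0]" "coord y = vector [0, 1, 0]" "coord z = vector [0, 0, 1]"
  using distinct by (simp_all add: coord_def representation_basis independent_Basis)

lemma point_coord: "point (coord u) = u"
proof -
  have "(\<Sum>b\<in>{x, y, z}. sc (representation {x, y, z} u b) b) = u"
    by (rule sum_representation_eq) (auto simp: independent_Basis span_Basis)
  then show ?thesis
    using distinct by (simp add: point_def coord_def add.assoc)
qed

lemma coord_point: "coord (point c) = c"
  by (simp add: point_def coord_add coord_scale coord_basis vec_eq_iff forall_3)

lemma coord_eq_iff: "u = v \<longleftrightarrow> coord u = coord v"
  using point_coord by metis

definition gram :: "('v \<Rightarrow> 'v \<Rightarrow> 'k) \<Rightarrow> 'k ^ 3"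
  where "gram \<omega> = vector [\<omega> y z, \<omega> z x, \<omega> x y]"

lemma skew_diagonal:
  assumes "(2 :: 'k) \<noteq> 0" "skew_symmetric f"
  shows "f u u = (0 :: 'v)"
proof -
  have "f u u = - f u u"
    using assms(2) unfolding skew_symmetric_def by blast
  then have "f u u + f u u = 0" by (metis add.right_inverse)
  then have "sc 2 (f u u) = 0"
    using scale_left_distrib[of 1 1 "f u u"] by simp
  then show ?thesis using assms(1) by simp
qed

lemma skew_form_eq:
  assumes two: "(2 :: 'k) \<noteq> 0" and bil: "bilinear_map sc (*) \<omega>" and skew: "skew_symmetric \<omega>"
  shows "\<omega> u v = form3 (gram \<omega>) (coord u) (coord v)"
proof -
  have lin: "\<omega> (a + b) c = \<omega> a c + \<omega> b c" "\<omega> a (b + c) = \<omega> a b + \<omega> a c"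
    "\<omega> (sc r a) b = r * \<omega> a b" "\<omega> a (sc r b) = r * \<omega> a b" for a b c r
    using bil by (simp_all add: bilinear_map_iff)
  have sk: "\<omega> a b = - \<omega> b a" for a b
    using skew unfolding skew_symmetric_def by blast
  have alt: "\<omega> a a = 0" for a
  proof -
    have "2 * \<omega> a a = 0" using sk[of a a] by (metis add.right_inverse mult_2)
    then show ?thesis using two by simp
  qed
  have "\<omega> (point c) (point d) = form3 (gram \<omega>) c d" for c d
    by (simp add: point_def lin alt form3_def gram_def sk[of y x] sk[of x z] sk[of z y] algebra_simps)
  then show ?thesis using point_coord by metis
qed

lemma bracket_eq:
  assumes two: "(2 :: 'k) \<noteq> 0" and bil: "bilinear_map sc sc br" and skew: "skew_symmetric br"
    and p: "structure_constants sc x y z br p"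
  shows "coord (br u v) = bracket3 p (coord u) (coord v)"
proof -
  have lin: "br (a + b) c = br a c + br b c" "br a (b + c) = br a b + br a c"
    "br (sc r a) b = sc r (br a b)" "br a (sc r b) = sc r (br a b)" for a b c r
    using bil by (simp_all add: bilinear_map_iff)
  have sk: "br a b = - br b a" for a b
    using skew unfolding skew_symmetric_def by blast
  have alt: "br a a = 0" for a by (rule skew_diagonal[OF two skew])
  have coord0: "coord 0 = 0" using coord_scale[of 0 0] by (simp add: vec_eq_iff)
  have xyz: "coord (br x y) = vector [p $ 1, p $ 2, p $ 3]"
    "coord (br x z) = vector [p $ 4, p $ 5, p $ 6]" "coord (br y z) = vector [p $ 7, p $ 8, p $ 9]"
    using p unfolding structure_constants_def
    by (simp_all add: coord_add coord_scale coord_basis vec_eq_iff forall_3)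
  have "coord (br (point c) (point d)) = bracket3 p c d" for c d
    by (simp add: point_def lin alt sk[of y x] sk[of z x] sk[of z y] coord_add coord_diff coord_scale coord_minus
        coord0 xyz bracket3_def vec_eq_iff forall_3 algebra_simps)
  then show ?thesis using point_coord by metis
qed

text \<open>
  In coordinates, a skew-symmetric bracket is the one given by its structure constants and \<open>\<omega>\<close> is the form with
  coefficients \<open>w\<close> (this is where \<open>2 \<noteq> 0\<close> enters: skew-symmetry must make the diagonal vanish). The defining
  identity then compares the forms with coefficients \<open>M t\<close> and \<open>w\<close>.
\<close>

theorem omega_lie_variety_eq_jac_locus:
  assumes two: "(2 :: 'k) \<noteq> 0" and bil: "bilinear_map sc (*) \<omega>" and skew: "skew_symmetric \<omega>"
  shows "omega_lie_variety sc x y z \<omega> = jac_locus UNIV (gram \<omega>)"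
proof (intro equalityI subsetI)
  fix p assume "p \<in> omega_lie_variety sc x y z \<omega>"
  then obtain br where br: "omega_lie_algebra sc br \<omega>" "structure_constants sc x y z br p"
    unfolding omega_lie_variety_def by blast
  then have "bilinear_map sc sc br" "skew_symmetric br"
    unfolding omega_lie_algebra_def by simp_all
  note coord_br = bracket_eq[OF two this br(2)]
  have "br (br x y) z + br (br y z) x + br (br z x) y
      = sc (\<omega> x y) z + sc (\<omega> y z) x + sc (\<omega> z x) y"
    using br(1) unfolding omega_lie_algebra_def by blast
  then have "coord (br (br x y) z + br (br y z) x + br (br z x) y)
      = coord (sc (\<omega> x y) z + sc (\<omega> y z) x + sc (\<omega> z x) y)" by simp
  then have "jac p = gram \<omega>"
    by (simp add: coord_add coord_scale coord_br bracket3_jacobi)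
       (simp add: coord_basis gram_def form3_def vec_eq_iff forall_3)
  then show "p \<in> jac_locus UNIV (gram \<omega>)" by (simp add: jac_locus_def)
next
  fix p assume "p \<in> jac_locus UNIV (gram \<omega>)"
  then have p: "jac p = gram \<omega>" by (simp add: jac_locus_def vec_eq_iff)
  define br where "br u v = point (bracket3 p (coord u) (coord v))" for u v
  have coord_br: "coord (br u v) = bracket3 p (coord u) (coord v)" for u v
    by (simp add: br_def coord_point)
  have "bilinear_map sc sc br"
    unfolding bilinear_map_iff
    by (auto intro: vector_space_axioms simp: coord_eq_iff coord_br coord_add coord_scale)
       (simp_all add: bracket3_def vec_eq_iff forall_3 algebra_simps)
  moreover have "skew_symmetric br"
    unfolding skew_symmetric_def
    by (simp add: coord_eq_iff[of "br _ _"] coord_br coord_minus) (simp add: bracket3_def vec_eq_iff algebra_simps)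
  moreover have "br (br u v) s + br (br v s) u + br (br s u) v
      = sc (\<omega> u v) s + sc (\<omega> v s) u + sc (\<omega> s u) v" for u v s
    by (simp add: coord_eq_iff[of "br _ _ + _ + _"] coord_br coord_add coord_scale bracket3_jacobi p skew_form_eq[OF two bil skew])
  moreover have "\<exists>B. finite_dimensional_vector_space sc B"
    using finite_dimensional_vector_space_axioms by blast
  ultimately have "omega_lie_algebra sc br \<omega>"
    using bil unfolding omega_lie_algebra_def by blast
  moreover have "structure_constants sc x y z br p"
    unfolding structure_constants_def
    by (simp add: coord_eq_iff[of "br _ _"] coord_br coord_add coord_scale coord_basis)
       (simp add: bracket3_def vec_eq_iff forall_3)
  ultimately show "p \<in> omega_lie_variety sc x y z \<omega>"
    unfolding omega_lie_variety_def by blast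
qed

lemma gram_nonzero:
  assumes "(2 :: 'k) \<noteq> 0" "bilinear_map sc (*) \<omega>" "skew_symmetric \<omega>" "\<omega> u v \<noteq> 0"
  shows "gram \<omega> \<noteq> 0"
  using assms(4) skew_form_eq[OF assms(1-3), of u v] by (auto simp: form3_def)

end

section \<open>The geometric variety\<close>

text \<open>
  Over a finite field, \<open>1 + \<Prod>\<^sub>a (X - a)\<close> has no root.
\<close>

lemma infinite_alg_closed_field: "infinite (UNIV :: 'f::alg_closed_field set)"
proof
  assume fin: "finite (UNIV :: 'f set)"
  define P where "P = (\<Prod>a\<in>(UNIV :: 'f set). [:- a, 1:])"
  have deg: "degree P = card (UNIV :: 'f set)"
    unfolding P_def by (subst degree_prod_eq_sum_degree) simp_all
  have "card (UNIV :: 'f set) > 0" using fin by (simp add: card_gt_0_iff)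
  then have "degree (P + 1) > 0"
    using deg by (simp add: degree_add_eq_left)
  then obtain x where "poly (P + 1) x = 0"
    using alg_closed_imp_poly_has_root by blast
  moreover have "poly P x = 0"
    unfolding P_def poly_prod using fin by (auto simp: prod_zero_iff)
  ultimately show False by simp
qed

lemma two_neq_zero_if_CHAR:
  assumes "CHAR('k::field) \<noteq> 2"
  shows "(2 :: 'k) \<noteq> 0"
proof
  assume "(2 :: 'k) = 0"
  then have "of_nat 2 = (0 :: 'k)" by simp
  then have "CHAR('k) dvd 2" by (simp only: of_nat_eq_0_iff_char_dvd)
  then have "CHAR('k) = 1 \<or> CHAR('k) = 2" 
    using two_is_prime_nat unfolding prime_nat_iff by blast
  then show False using assms by simp
qed

lemma finite_UNIV_vec:
  assumes "finite (UNIV :: 'k set)"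
  shows "finite (UNIV :: ('k ^ 'n::finite) set)"
proof (rule inj_on_finite)
  show "inj (vec_nth :: 'k ^ 'n \<Rightarrow> 'n \<Rightarrow> 'k)" by (simp add: inj_def vec_eq_iff fun_eq_iff)
  show "finite (PiE UNIV (\<lambda>_. UNIV) :: ('n \<Rightarrow> 'k) set)" using assms by (intro finite_PiE) simp_all
qed simp

lemma infinite_extension_to_ac: "infinite_extension (to_ac :: 'k::field \<Rightarrow> 'k alg_closure)"
  by unfold_locales (simp_all add: infinite_alg_closed_field)

lemma three_dimensional_axes:
  "three_dimensional ((*s) :: 'f::field \<Rightarrow> 'f ^ 3 \<Rightarrow> 'f ^ 3) (axis 1 1) (axis 2 1) (axis 3 1)"
proof -
  have basis: "{axis 1 1, axis 2 1, axis 3 1} = (cart_basis :: ('f ^ 3) set)"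
    unfolding cart_basis_def using exhaust_3 by (auto, metis)
  show ?thesis
    unfolding three_dimensional_def three_dimensional_axioms_def basis
    using vec.finite_dimensional_vector_space_axioms card_cart_basis[where 'i = 3 and 'a = 'f] by simp
qed

lemma geometric_form_eq:
  "geometric_form x y z \<omega> u v = (\<Sum>i\<in>UNIV. \<Sum>j\<in>UNIV. u $ i * v $ j *
    to_ac (\<omega> (vector [x, y, z] $ i) (vector [x, y, z] $ j)))"
  by (simp add: geometric_form_def Let_def)

lemma bilinear_geometric_form: "bilinear_map (*s) (*) (geometric_form x y z \<omega>)"
  unfolding bilinear_map_iff geometric_form_eq
  by (intro conjI allI vec.vector_space_axioms vector_space_field)
     (simp_all add: distrib_left distrib_right sum.distrib sum_distrib_left mult_ac)

lemma skew_geometric_form: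
  fixes x y z :: "'v::zero"
  assumes "skew_symmetric \<omega>"
  shows "skew_symmetric (geometric_form x y z \<omega>)"
proof -
  let ?e = "($) (vector [x, y, z] :: 'v ^ 3)"
  have sk: "to_ac (\<omega> a b) = - to_ac (\<omega> b a)" for a b
    using assms unfolding skew_symmetric_def by (metis to_ac_minus)
  have "geometric_form x y z \<omega> u v = - geometric_form x y z \<omega> v u" for u v
  proof -
    have "geometric_form x y z \<omega> u v
        = (\<Sum>j\<in>UNIV. \<Sum>i\<in>UNIV. u $ i * v $ j * to_ac (\<omega> (?e i) (?e j)))"
      unfolding geometric_form_eq by (rule sum.swap)
    also have "\<dots> = (\<Sum>j\<in>UNIV. \<Sum>i\<in>UNIV. - (v $ j * u $ i * to_ac (\<omega> (?e j) (?e i))))"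
      by (intro sum.cong refl) (subst sk, simp)
    also have "\<dots> = - geometric_form x y z \<omega> v u"
      by (simp add: geometric_form_eq sum_negf)
    finally show ?thesis .
  qed
  then show ?thesis unfolding skew_symmetric_def by blast
qed

lemma geometric_gram:
  "three_dimensional.gram (axis 1 1) (axis 2 1) (axis 3 1) (geometric_form x y z \<omega>)
    = vmap to_ac (vector [\<omega> y z, \<omega> z x, \<omega> x y])"
  unfolding three_dimensional.gram_def[OF three_dimensional_axes]
  by (simp add: geometric_form_eq sum_3 axis_def vec_eq_iff forall_3)

section \<open>The vanishing ideal of a Jacobi locus is a complete intersection\<close>

context infinite_extension
begin

text \<open>
  Since the list contains an index \<open>i\<close> with \<open>w\<^sub>i \<noteq> 0\<close>, the locus of its equations is rationally connected and its
  ideal is prime; the next equation fails at some point of the locus because Jacobi vectors are arbitrary.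
\<close>

lemma regular_sequence_jac_poly_snoc:
  fixes w :: "'k ^ 3"
  assumes reg: "regular_sequence (map (jac_poly w) is)"
    and i: "i \<in> set is" "w $ i \<noteq> 0" and j: "j \<notin> set is"
  shows "regular_sequence (map (jac_poly w) is @ [jac_poly w j])"
proof (rule regular_sequence_snoc[OF reg])
  let ?w = "vmap h w"
  have ideal: "ideal_gen (jac_poly w ` I) = vanishing_ideal_over h (jac_locus I ?w)" if "i \<in> I" for I
    using vanishing_ideal_jac_locus[OF that i(2)] by simp
  have wi: "?w $ i \<noteq> 0" using i(2) by simp
  have "1 \<notin> vanishing_ideal_over h (jac_locus (insert j (set is)) ?w)"
    using jac_locus_nonempty by (auto simp: vanishing_ideal_over_def)
  then show "ideal_gen (set (map (jac_poly w) is @ [jac_poly w j])) \<noteq> UNIV"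
    using ideal[of "insert j (set is)"] i(1) by auto
  fix f assume "jac_poly w j * f \<in> ideal_gen (set (map (jac_poly w) is))"
  then have "jac_poly w j * f \<in> vanishing_ideal_over h (jac_locus (set is) ?w)"
    using ideal[OF i(1)] by simp
  moreover have "jac_poly w j \<notin> vanishing_ideal_over h (jac_locus (set is) ?w)"
  proof -
    obtain p where p: "jac p = ?w + axis j 1"
      using jac_point_exists[of 1 "?w + axis j 1" 0 0 0 0 0] by auto
    then have "p \<in> jac_locus (set is) ?w"
      using j by (auto simp: jac_locus_def axis_def)
    moreover have "eval_mpoly_over h p (jac_poly w j) \<noteq> 0"
      using p by (simp add: eval_jac_poly axis_def)
    ultimately show ?thesis by (auto simp: vanishing_ideal_over_def)
  qed
  ultimately show "f \<in> ideal_gen (set (map (jac_poly w) is))"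
    using vanishing_ideal_prime[OF rationally_connected_jac_locus[OF i(1) wi]] ideal[OF i(1)] by auto
qed

lemma regular_sequence_jac_poly_single:
  fixes w :: "'k ^ 3"
  shows "regular_sequence [jac_poly w i]"
proof -
  have nonzero: "jac_poly w i \<noteq> 0"
  proof
    assume 0: "jac_poly w i = 0"
    obtain p where p: "jac p = vmap h w + axis i 1"
      using jac_point_exists[of 1 "vmap h w + axis i 1" 0 0 0 0 0] by auto
    then have "eval_mpoly_over h p (jac_poly w i) \<noteq> 0"
      by (simp add: eval_jac_poly axis_def)
    with 0 show False by simp
  qed
  have "rationally_connected (UNIV :: ('f ^ 9) set)"
    by (rule rationally_connected_affine) simp
  from vanishing_ideal_prime[OF this]
  have dom: "f = 0 \<or> g = 0" if "f * g = 0" for f g :: "(9, 'k) mpoly"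
    using that by (simp add: vanishing_ideal_UNIV)
  have "regular_sequence ([] @ [jac_poly w i])"
  proof (rule regular_sequence_snoc[OF regular_sequence_Nil])
    obtain p where "p \<in> jac_locus {i} (vmap h w)" using jac_locus_nonempty by blast
    then have "jac_poly w i \<in> vanishing_ideal_over h {p}"
      by (simp add: vanishing_ideal_over_def jac_locus_def eval_jac_poly)
    then have "ideal_gen {jac_poly w i} \<subseteq> vanishing_ideal_over h {p}"
      by (intro ideal.span_minimal subspace_vanishing_ideal) simp
    moreover have "1 \<notin> vanishing_ideal_over h {p}" by (simp add: vanishing_ideal_over_def)
    ultimately show "ideal_gen (set ([] @ [jac_poly w i])) \<noteq> UNIV" by auto
    show "f \<in> ideal_gen (set [])" if "jac_poly w i * f \<in> ideal_gen (set [])" for f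
      using that dom nonzero by (auto simp: ideal.span_empty)
  qed
  then show ?thesis by simp
qed

text \<open>
  An equation with \<open>w\<^sub>i \<noteq> 0\<close> is put first. Otherwise the zero set of the first equations would contain the points
  with \<open>t = 0\<close>.
\<close>

theorem complete_intersection_jac_locus:
  fixes w :: "'k ^ 3"
  assumes "w \<noteq> 0"
  shows "complete_intersection (vanishing_ideal_over h (jac_locus UNIV (vmap h w)))"
proof -
  obtain i where i: "w $ i \<noteq> 0" using assms by (auto simp: vec_eq_iff)
  obtain j k where jk: "distinct [i, j, k]"
  proof -
    consider "i = 1" | "i = 2" | "i = 3" using exhaust_3 by blast
    then show ?thesis
      by cases (use that[of 2 3] that[of 1 3] that[of 1 2] in simp_all)
  qed
  have "card (set [i, j, k]) = CARD(3)" using distinct_card[OF jk] by simp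
  then have UNIV: "set [i, j, k] = UNIV" by (intro card_subset_eq) simp_all
  have j: "j \<notin> set [i]" and k: "k \<notin> set [i, j]" using jk by auto
  have "regular_sequence (map (jac_poly w) [i])"
    using regular_sequence_jac_poly_single by simp
  then have "regular_sequence (map (jac_poly w) [i, j])"
    using regular_sequence_jac_poly_snoc[of w "[i]" i j, OF _ _ i j] by simp
  then have "regular_sequence (map (jac_poly w) [i, j, k])"
    using regular_sequence_jac_poly_snoc[of w "[i, j]" i k, OF _ _ i k] by simp
  moreover have "vanishing_ideal_over h (jac_locus UNIV (vmap h w))
      = ideal_gen (set (map (jac_poly w) [i, j, k]))"
    unfolding set_map UNIV by (rule vanishing_ideal_jac_locus[OF UNIV_I i])
  ultimately show ?thesis unfolding complete_intersection_def by blast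
qed

end

section \<open>The variety of omega-Lie algebras\<close>

theorem theorem1p2:
  fixes sc :: "'k::field \<Rightarrow> 'v::ab_group_add \<Rightarrow> 'v"
    and x y z :: 'v
    and \<omega> :: "'v \<Rightarrow> 'v \<Rightarrow> 'k"
  assumes char: "CHAR('k) \<noteq> 2"
    and basis: "finite_dimensional_vector_space sc {x, y, z}" "card {x, y, z} = 3"
    and form: "bilinear_map sc (*) \<omega>" "skew_symmetric \<omega>" "\<exists>u v. \<omega> u v \<noteq> 0"
  defines "A \<equiv> omega_lie_variety sc x y z \<omega>"
    and "A_geom \<equiv> geometric_omega_lie_variety x y z \<omega>"
  shows "zariski_closed A \<and> complete_intersection (vanishing_ideal A) \<and>
    (infinite (UNIV :: 'k set) \<longrightarrow> irreducible_variety A \<and> variety_dim A = 6) \<and>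
    irreducible_variety A_geom \<and> variety_dim A_geom = 6 \<and>
    complete_intersection (vanishing_ideal_over to_ac A_geom)"
proof -
  interpret V: three_dimensional sc x y z
    using basis by (simp add: three_dimensional_def three_dimensional_axioms_def)
  interpret ac: infinite_extension "to_ac :: 'k \<Rightarrow> 'k alg_closure"
    by (rule infinite_extension_to_ac)
  have two: "(2 :: 'k) \<noteq> 0" by (rule two_neq_zero_if_CHAR[OF char])
  then have two_ac: "(2 :: 'k alg_closure) \<noteq> 0"
    using ac.h_eq_0_iff[of 2] ac.h_2 by simp
  define w where "w = V.gram \<omega>"
  have A: "A = jac_locus UNIV w"
    unfolding A_def w_def by (rule V.omega_lie_variety_eq_jac_locus[OF two form(1,2)])
  have A_geom: "A_geom = jac_locus UNIV (vmap to_ac w)"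
    unfolding A_geom_def geometric_omega_lie_variety_def w_def V.gram_def geometric_gram[symmetric]
    by (rule three_dimensional.omega_lie_variety_eq_jac_locus[OF three_dimensional_axes two_ac
          bilinear_geometric_form skew_geometric_form[OF form(2)]])
  have "w \<noteq> 0"
    using form(3) V.gram_nonzero[OF two form(1,2)] unfolding w_def by blast
  then obtain i where i: "w $ i \<noteq> 0" by (auto simp: vec_eq_iff)
  then have i_ac: "vmap to_ac w $ i \<noteq> 0" by simp
  have inf_ac: "infinite (UNIV :: 'k alg_closure set)" by (rule infinite_alg_closed_field)
  have "complete_intersection (vanishing_ideal A)"
  proof (cases "finite (UNIV :: 'k set)")
    case True
    then have "finite (UNIV :: ('k ^ 9) set)" by (rule finite_UNIV_vec)
    then have "finite A" by (rule rev_finite_subset) simp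
    then show ?thesis
      using jac_locus_nonempty unfolding A by (rule ac.complete_intersection_finite)
  next
    case False
    have "vmap (\<lambda>c. c) w = w" by (simp add: vec_eq_iff)
    then show ?thesis
      using infinite_extension.complete_intersection_jac_locus[OF infinite_extension_id[OF False] \<open>w \<noteq> 0\<close>]
      unfolding A by simp
  qed
  moreover have "complete_intersection (vanishing_ideal_over to_ac A_geom)"
    unfolding A_geom by (rule ac.complete_intersection_jac_locus[OF \<open>w \<noteq> 0\<close>])
  ultimately show ?thesis
    unfolding A A_geom
    using zariski_closed_jac_locus irreducible_jac_locus[OF _ UNIV_I i] variety_dim_jac_locus[OF _ i]
      irreducible_jac_locus[OF inf_ac UNIV_I i_ac] variety_dim_jac_locus[OF inf_ac i_ac]
    by blast
qed

end
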